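(* There is an algorithm that, given a Maker-Breaker poset positional game $(X,\mathcal{F},P)$ in which $P$ consists of pairwise disjoint chains each of height at most $2$ and every winning set has size at most $2$, decides which player has a winning strategy when Maker starts, in time $O(|X|^4)$.
   Context: A poset positional game is a triple $(X,\mathcal{F},P)$ with $X$ a finite board of vertices, $\mathcal{F}\subseteq 2^X$ the winning sets, and $P$ a partial order on $X$. Two players alternately claim an unclaimed vertex $v$ such that all vertices smaller than $v$ in $P$ are already claimed, until all vertices are claimed. In the Maker-Breaker convention, Maker wins if she claims all vertices of some winning set; otherwise Breaker wins. A poset made of pairwise disjoint chains has its ground set partitioned into chains with elements of distinct chains incomparable; the height of a chain is its number of elements. *)

theory Defs
  imports Complex_Main "HOL-Library.Disjoint_Sets" "HOL-Library.Landau_Symbols"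
begin

section \<open>Poset positional games\<close>

text \<open>The partial order is reflexive: \<open>(u, v) \<in> P\<close> means \<open>u \<le> v\<close>.\<close>

definition poset_positional_game :: "'a set \<Rightarrow> 'a set set \<Rightarrow> 'a rel \<Rightarrow> bool" where
  "poset_positional_game X F P \<longleftrightarrow> finite X \<and> F \<subseteq> Pow X \<and> partial_order_on X P"

definition disjoint_chains :: "'a set \<Rightarrow> 'a rel \<Rightarrow> nat \<Rightarrow> bool" where
  "disjoint_chains X P h \<longleftrightarrow>
     (\<exists>\<C>. partition_on X \<C> \<and>
          (\<forall>C\<in>\<C>. C \<in> Chains P \<and> card C \<le> h) \<and>
          (\<forall>C\<in>\<C>. \<forall>D\<in>\<C>. C \<noteq> D \<longrightarrow> (\<forall>x\<in>C. \<forall>y\<in>D. (x, y) \<notin> P \<and> (y, x) \<notin> P)))"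

definition available :: "'a set \<Rightarrow> 'a rel \<Rightarrow> 'a set \<Rightarrow> 'a \<Rightarrow> bool" where
  "available X P claimed v \<longleftrightarrow>
     v \<in> X \<and> v \<notin> claimed \<and> (\<forall>u. (u, v) \<in> P \<and> u \<noteq> v \<longrightarrow> u \<in> claimed)"

text \<open>A play, possibly unfinished, is the list of the vertices claimed so far, in
  chronological order. It is finished when all vertices of the board are claimed.\<close>

definition legal_play :: "'a set \<Rightarrow> 'a rel \<Rightarrow> 'a list \<Rightarrow> bool" where
  "legal_play X P h \<longleftrightarrow> (\<forall>i<length h. available X P (set (take i h)) (h ! i))"

datatype player = Maker | Breaker

text \<open>Moves are numbered from 0, and Maker starts.\<close>

definition mover :: "nat \<Rightarrow> player" where
  "mover i = (if even i then Maker else Breaker)"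

definition claimed_by :: "player \<Rightarrow> 'a list \<Rightarrow> 'a set" where
  "claimed_by p h = {h ! i | i. i < length h \<and> mover i = p}"

definition winner :: "'a set set \<Rightarrow> 'a list \<Rightarrow> player" where
  "winner F h = (if \<exists>S\<in>F. S \<subseteq> claimed_by Maker h then Maker else Breaker)"

text \<open>A strategy maps the play so far to the next move.\<close>

definition follows :: "player \<Rightarrow> ('a list \<Rightarrow> 'a) \<Rightarrow> 'a list \<Rightarrow> bool" where
  "follows p \<sigma> h \<longleftrightarrow> (\<forall>i<length h. mover i = p \<longrightarrow> h ! i = \<sigma> (take i h))"

definition is_strategy :: "'a set \<Rightarrow> 'a rel \<Rightarrow> player \<Rightarrow> ('a list \<Rightarrow> 'a) \<Rightarrow> bool" where
  "is_strategy X P p \<sigma> \<longleftrightarrow>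
     (\<forall>h. legal_play X P h \<and> follows p \<sigma> h \<and> set h \<noteq> X \<and> mover (length h) = p
          \<longrightarrow> available X P (set h) (\<sigma> h))"

definition has_winning_strategy :: "'a set \<Rightarrow> 'a set set \<Rightarrow> 'a rel \<Rightarrow> player \<Rightarrow> bool" where
  "has_winning_strategy X F P p \<longleftrightarrow>
     (\<exists>\<sigma>. is_strategy X P p \<sigma> \<and>
          (\<forall>h. legal_play X P h \<and> set h = X \<and> follows p \<sigma> h \<longrightarrow> winner F h = p))"

section \<open>Games as inputs\<close>

text \<open>A game is presented as the list
  \<^item> number of vertices, number of strict order relations, number of winning sets;
  \<^item> the strict order relations, as pairs (smaller vertex, larger vertex);
  \<^item> the winning sets, each as its size followed by its elements.

  Vertices are represented by their number in an arbitrary numbering \<open>\<nu>\<close> from 0. Relations,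
  winning sets and elements are listed in arbitrary order, without repetition.\<close>

definition encodes :: "nat list \<Rightarrow> 'a set \<Rightarrow> 'a set set \<Rightarrow> 'a rel \<Rightarrow> bool" where
  "encodes xs X F P \<longleftrightarrow>
     (\<exists>(\<nu> :: 'a \<Rightarrow> nat) (rs :: (nat \<times> nat) list) (es :: nat list list).
        bij_betw \<nu> X {..<card X} \<and>
        distinct rs \<and> set rs = map_prod \<nu> \<nu> ` (P - Id) \<and>
        (\<forall>e\<in>set es. distinct e) \<and> distinct (map set es) \<and> set (map set es) = image \<nu> ` F \<and>
        xs = [card X, length rs, length es]
             @ concat (map (\<lambda>(a, b). [a, b]) rs)
             @ concat (map (\<lambda>e. length e # e) es))"

section \<open>A word RAM\<close>

text \<open>Programs are while-programs over scalar variables and arrays (with constant-time access),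
  all holding natural numbers. For a word length of \<open>w\<close> bits, a computation gets stuck as soon
  as it evaluates an expression one of whose subexpressions has a value of at least \<open>2 ^ w\<close>.
  Subtraction is truncated at 0. Every operation costs one time unit.\<close>

datatype exp =
    Const nat
  | Var string
  | Arr string exp
  | Plus exp exp
  | Minus exp exp
  | Times exp exp

datatype bexp =
    Less exp exp
  | Equal exp exp
  | BNot bexp
  | BAnd bexp bexp

datatype com =
    Skip
  | Assign string exp
  | Store string exp exp
  | Seq com com
  | Cond bexp com com
  | While bexp com

record state =
  vars :: "string \<Rightarrow> nat"
  arrs :: "string \<Rightarrow> nat \<Rightarrow> nat"

primrec val :: "exp \<Rightarrow> state \<Rightarrow> nat" where
  "val (Const k) s = k"
| "val (Var x) s = vars s x"
| "val (Arr a i) s = arrs s a (val i s)"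
| "val (Plus d e) s = val d s + val e s"
| "val (Minus d e) s = val d s - val e s"
| "val (Times d e) s = val d s * val e s"

primrec fits :: "nat \<Rightarrow> exp \<Rightarrow> state \<Rightarrow> bool" where
  "fits w (Const k) s \<longleftrightarrow> k < 2 ^ w"
| "fits w (Var x) s \<longleftrightarrow> vars s x < 2 ^ w"
| "fits w (Arr a i) s \<longleftrightarrow> fits w i s \<and> arrs s a (val i s) < 2 ^ w"
| "fits w (Plus d e) s \<longleftrightarrow> fits w d s \<and> fits w e s \<and> val d s + val e s < 2 ^ w"
| "fits w (Minus d e) s \<longleftrightarrow> fits w d s \<and> fits w e s"
| "fits w (Times d e) s \<longleftrightarrow> fits w d s \<and> fits w e s \<and> val d s * val e s < 2 ^ w"

primrec cost :: "exp \<Rightarrow> nat" where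
  "cost (Const k) = 1"
| "cost (Var x) = 1"
| "cost (Arr a i) = 1 + cost i"
| "cost (Plus d e) = 1 + cost d + cost e"
| "cost (Minus d e) = 1 + cost d + cost e"
| "cost (Times d e) = 1 + cost d + cost e"

primrec bval :: "bexp \<Rightarrow> state \<Rightarrow> bool" where
  "bval (Less d e) s \<longleftrightarrow> val d s < val e s"
| "bval (Equal d e) s \<longleftrightarrow> val d s = val e s"
| "bval (BNot b) s \<longleftrightarrow> \<not> bval b s"
| "bval (BAnd b c) s \<longleftrightarrow> bval b s \<and> bval c s"

primrec bfits :: "nat \<Rightarrow> bexp \<Rightarrow> state \<Rightarrow> bool" where
  "bfits w (Less d e) s \<longleftrightarrow> fits w d s \<and> fits w e s"
| "bfits w (Equal d e) s \<longleftrightarrow> fits w d s \<and> fits w e s"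
| "bfits w (BNot b) s \<longleftrightarrow> bfits w b s"
| "bfits w (BAnd b c) s \<longleftrightarrow> bfits w b s \<and> bfits w c s"

primrec bcost :: "bexp \<Rightarrow> nat" where
  "bcost (Less d e) = 1 + cost d + cost e"
| "bcost (Equal d e) = 1 + cost d + cost e"
| "bcost (BNot b) = 1 + bcost b"
| "bcost (BAnd b c) = 1 + bcost b + bcost c"

text \<open>\<open>exec w c s t s'\<close>: with word length \<open>w\<close>, program \<open>c\<close> started in state \<open>s\<close> halts in
  state \<open>s'\<close> after \<open>t\<close> time units.\<close>

inductive exec :: "nat \<Rightarrow> com \<Rightarrow> state \<Rightarrow> nat \<Rightarrow> state \<Rightarrow> bool" for w where
  Skip: "exec w Skip s 1 s"
| Assign: "fits w e s \<Longrightarrow>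
    exec w (Assign x e) s (1 + cost e) (s\<lparr>vars := (vars s)(x := val e s)\<rparr>)"
| Store: "fits w i s \<Longrightarrow> fits w e s \<Longrightarrow>
    exec w (Store a i e) s (1 + cost i + cost e)
      (s\<lparr>arrs := (arrs s)(a := (arrs s a)(val i s := val e s))\<rparr>)"
| Seq: "exec w c s t s' \<Longrightarrow> exec w d s' u s'' \<Longrightarrow> exec w (Seq c d) s (t + u) s''"
| CondTrue: "bfits w b s \<Longrightarrow> bval b s \<Longrightarrow> exec w c s t s' \<Longrightarrow>
    exec w (Cond b c d) s (1 + bcost b + t) s'"
| CondFalse: "bfits w b s \<Longrightarrow> \<not> bval b s \<Longrightarrow> exec w d s t s' \<Longrightarrow>
    exec w (Cond b c d) s (1 + bcost b + t) s'"
| WhileFalse: "bfits w b s \<Longrightarrow> \<not> bval b s \<Longrightarrow> exec w (While b c) s (1 + bcost b) s"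
| WhileTrue: "bfits w b s \<Longrightarrow> bval b s \<Longrightarrow> exec w c s t s' \<Longrightarrow> exec w (While b c) s' u s'' \<Longrightarrow>
    exec w (While b c) s (1 + bcost b + t + u) s''"

definition initial_state :: "nat list \<Rightarrow> state" where
  "initial_state xs =
     \<lparr>vars = (\<lambda>_. 0),
      arrs = (\<lambda>a i. if a = ''input'' \<and> i < length xs then xs ! i else 0)\<rparr>"

definition result :: "state \<Rightarrow> nat" where
  "result s = vars s ''result''"

end

theory Submission
  imports Defs "HOL-Real_Asymp.Real_Asymp"
begin

text \<open>Call a vertex accessible if it is unblocked, or if it lies above some \<open>b\<close> such that \<open>{b, z}\<close> is
  a winning set for an accessible \<open>z\<close>. Claiming one end of such a pair forces Breaker to claim the other
  end, and either way the top of \<open>b\<close> is freed while Maker keeps the move. Hence Maker wins if the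
  winning sets restricted to accessible vertices contain the empty set, a singleton, or two pairs
  sharing a vertex. Otherwise the accessible pairs form a matching. If the number of vertices is even,
  Breaker can always answer so that this persists: he answers in the matching, or with the top of the
  chain where Maker moved, or with a harmless move that exists by parity.

  If the number of vertices is odd, Maker makes the last move, and a winning set \<open>{t}\<close> with a blocked top
  \<open>t\<close> wins for her as well: she plays outside that chain until nothing else is left, and then it is
  Breaker who has to free \<open>t\<close>. She obtains such a singleton from any pair containing a blocked top,
  except when the pair is the chain itself. If there is no such singleton or pair, Breaker answers
  in the matching.

  Both conditions are evaluated in cubic time from the adjacency matrix of the pairs, and reading
  the input takes quadratic time.\<close>

section \<open>Positions and strategies\<close>

text \<open>In the even case the obstacle is that the accessible partner \<open>w\<close> of Maker's
  vertex \<open>u\<close> may still be a blocked top, out of Breaker's reach. The singleton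
  \<open>{w}\<close> that results is harmless as long as \<open>w\<close> stays inaccessible: if
  Maker frees it herself, Breaker claims it. So the invariant is the absence of a double threat, not
  of singletons, and Breaker's answer cuts off the derivation that made \<open>w\<close> accessible.
  On an odd board it is Breaker who runs out of waiting moves, so there every singleton counts. What
  the failed criterion leaves in that case is so rigid (disjoint pairs whose ends are free or form
  one chain) that plain pairing works, without any parity argument.

  Each player's win is certified separately on residual positions and turned into a strategy. Since
  both strategies cannot exist, the two implications become equivalences. The criterion is invariant
  under renumbering, so strategies never have to be transported between the board and the numbers in
  the input.\<close>

definition unblocked :: "'a rel \<Rightarrow> 'a set \<Rightarrow> 'a \<Rightarrow> bool" where
  "unblocked L R v \<longleftrightarrow> v \<in> R \<and> (\<forall>u. (u, v) \<in> L \<longrightarrow> u \<notin> R)"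

definition maker_claims :: "'a \<Rightarrow> 'a set set \<Rightarrow> 'a set set" where
  "maker_claims v E = (\<lambda>S. S - {v}) ` E"

definition breaker_claims :: "'a \<Rightarrow> 'a set set \<Rightarrow> 'a set set" where
  "breaker_claims v E = {S \<in> E. v \<notin> S}"

text \<open>Neither outcome is defined as the negation of the other: a derivation is a finite
  certificate from which a strategy can be read off. \<open>won\<close> may stop early, since an
  emptied winning set stays emptied. The premise \<open>R \<noteq> {}\<close> keeps the universally
  quantified rule from holding vacuously on an exhausted board.\<close>

inductive maker_wins :: "'a rel \<Rightarrow> player \<Rightarrow> 'a set \<Rightarrow> 'a set set \<Rightarrow> bool" for L where
  won: "{} \<in> E \<Longrightarrow> maker_wins L p R E"
| maker: "unblocked L R v \<Longrightarrow> maker_wins L Breaker (R - {v}) (maker_claims v E) \<Longrightarrow>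
    maker_wins L Maker R E"
| breaker: "R \<noteq> {} \<Longrightarrow>
    (\<And>v. unblocked L R v \<Longrightarrow> maker_wins L Maker (R - {v}) (breaker_claims v E)) \<Longrightarrow>
    maker_wins L Breaker R E"

text \<open>Breaker's success can be certified only on the exhausted board, so \<open>over\<close>
  is the sole base case, whoever is to move.\<close>

inductive breaker_wins :: "'a rel \<Rightarrow> player \<Rightarrow> 'a set \<Rightarrow> 'a set set \<Rightarrow> bool" for L where
  over: "{} \<notin> E \<Longrightarrow> breaker_wins L p {} E"
| breaker: "unblocked L R v \<Longrightarrow> breaker_wins L Maker (R - {v}) (breaker_claims v E) \<Longrightarrow>
    breaker_wins L Breaker R E"
| maker: "R \<noteq> {} \<Longrightarrow>
    (\<And>v. unblocked L R v \<Longrightarrow> breaker_wins L Breaker (R - {v}) (maker_claims v E)) \<Longrightarrow>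
    breaker_wins L Maker R E"

text \<open>Strategies see the whole play, so the recursive outcome is restated over histories; this
  mediates between positions and strategies.\<close>

inductive forces :: "'a set \<Rightarrow> 'a set set \<Rightarrow> 'a rel \<Rightarrow> player \<Rightarrow> 'a list \<Rightarrow> bool" for X F P p where
  over: "set h = X \<Longrightarrow> winner F h = p \<Longrightarrow> forces X F P p h"
| own: "set h \<noteq> X \<Longrightarrow> mover (length h) = p \<Longrightarrow> available X P (set h) v \<Longrightarrow>
    forces X F P p (h @ [v]) \<Longrightarrow> forces X F P p h"
| other: "set h \<noteq> X \<Longrightarrow> mover (length h) \<noteq> p \<Longrightarrow>
    (\<And>v. available X P (set h) v \<Longrightarrow> forces X F P p (h @ [v])) \<Longrightarrow> forces X F P p h"

section \<open>Plays, strategies, and why the players cannot both win\<close>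

lemma legal_play_snoc:
  "legal_play X P (h @ [v]) \<longleftrightarrow> legal_play X P h \<and> available X P (set h) v"
  unfolding legal_play_def by (auto simp: less_Suc_eq nth_append)

lemma legal_play_Nil [simp]: "legal_play X P []"
  by (simp add: legal_play_def)

lemma follows_snoc:
  "follows p \<sigma> (h @ [v]) \<longleftrightarrow> follows p \<sigma> h \<and> (mover (length h) = p \<longrightarrow> v = \<sigma> h)"
  unfolding follows_def by (auto simp: less_Suc_eq nth_append)

lemma legal_play_subset: "legal_play X P h \<Longrightarrow> set h \<subseteq> X"
  by (induction h rule: rev_induct) (auto simp: legal_play_snoc available_def)

lemma legal_play_distinct: "legal_play X P h \<Longrightarrow> distinct h"
  by (induction h rule: rev_induct) (auto simp: legal_play_snoc available_def)

text \<open>The strict order restricted to the unclaimed vertices is acyclic and finite, hence has a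
  minimal vertex. This keeps strategies from getting stuck.\<close>

lemma available_exists:
  assumes "poset_positional_game X F P" "C \<subset> X"
  shows "\<exists>v. available X P C v"
proof -
  have fin: "finite X" and po: "partial_order_on X P"
    using assms by (auto simp: poset_positional_game_def)
  let ?r = "(P - Id) \<inter> (X - C) \<times> (X - C)"
  have PX: "P \<subseteq> X \<times> X" and tr: "trans P" and an: "antisym P"
    using po by (auto simp: partial_order_on_def preorder_on_def refl_on_def)
  have "trans ?r"
    using tr an unfolding trans_def antisym_def by blast
  then have "acyclic ?r"
    by (auto simp: acyclic_def trancl_id)
  moreover have "finite ?r"
    using fin by auto
  ultimately have "wf ?r"
    by (rule finite_acyclic_wf[rotated])
  moreover have "X - C \<noteq> {}"
    using assms by auto
  ultimately obtain v where v: "v \<in> X - C" "\<And>u. (u, v) \<in> ?r \<Longrightarrow> u \<notin> X - C"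
    by (metis wfE_min')
  then have "available X P C v"
    using PX unfolding available_def by auto
  then show ?thesis ..
qed

lemma forces_winning_strategy:
  assumes game: "poset_positional_game X F P" and "forces X F P p []"
  shows "has_winning_strategy X F P p"
proof -
  define good where "good h v \<longleftrightarrow> available X P (set h) v \<and> forces X F P p (h @ [v])" for h v
  \<comment> \<open>The second choice is a default for histories without a \<open>good\<close> move;
    it lets legality be proved before it is known that such histories do not arise on the turns of
    \<open>p\<close>.\<close>
  define \<sigma> where "\<sigma> h = (if \<exists>v. good h v then SOME v. good h v
      else SOME v. available X P (set h) v)" for h
  have strat: "is_strategy X P p \<sigma>"
    unfolding is_strategy_def
  proof (intro allI impI, elim conjE)
    fix h assume h: "legal_play X P h" "set h \<noteq> X"
    then have "\<exists>v. available X P (set h) v"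
      using available_exists[OF game, of "set h"] legal_play_subset by blast
    then show "available X P (set h) (\<sigma> h)"
      unfolding \<sigma>_def by (metis good_def someI_ex)
  qed
  have forced: "legal_play X P h \<Longrightarrow> follows p \<sigma> h \<Longrightarrow> forces X F P p h" for h
  proof (induction h rule: rev_induct)
    case Nil
    show ?case by fact
  next
    case (snoc v h)
    then have av: "available X P (set h) v" and fo: "forces X F P p h"
      and vs: "mover (length h) = p \<Longrightarrow> v = \<sigma> h"
      by (auto simp: legal_play_snoc follows_snoc)
    from fo show ?case
    proof cases
      case over
      then show ?thesis using av by (auto simp: available_def)
    next
      case (own u)
      then have "\<exists>v. good h v" by (auto simp: good_def)
      then have "good h (\<sigma> h)" unfolding \<sigma>_def by (metis someI_ex)
      then show ?thesis using vs own by (simp add: good_def)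
    next
      case other
      then show ?thesis using av by simp
    qed
  qed
  have "winner F h = p" if "legal_play X P h" "set h = X" "follows p \<sigma> h" for h
    using forced[OF that(1,3)] that(2)
    by cases (auto simp: available_def)
  with strat show ?thesis
    unfolding has_winning_strategy_def by blast
qed

text \<open>Letting the two strategies play against each other yields one complete play with two
  winners.\<close>

lemma not_both_winning_strategies:
  assumes game: "poset_positional_game X F P"
    and "has_winning_strategy X F P Maker" "has_winning_strategy X F P Breaker"
  shows False
proof -
  from assms obtain \<sigma> \<tau> where
    \<sigma>: "is_strategy X P Maker \<sigma>"
      "\<And>h. legal_play X P h \<Longrightarrow> set h = X \<Longrightarrow> follows Maker \<sigma> h \<Longrightarrow> winner F h = Maker" and
    \<tau>: "is_strategy X P Breaker \<tau>"
      "\<And>h. legal_play X P h \<Longrightarrow> set h = X \<Longrightarrow> follows Breaker \<tau> h \<Longrightarrow> winner F h = Breaker"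
    unfolding has_winning_strategy_def by metis
  have fin: "finite X" using game by (simp add: poset_positional_game_def)
  have "\<exists>h. legal_play X P h \<and> follows Maker \<sigma> h \<and> follows Breaker \<tau> h \<and> length h = k"
    if "k \<le> card X" for k
    using that
  proof (induction k)
    case 0
    then show ?case by (simp add: follows_def)
  next
    case (Suc k)
    then obtain h where h: "legal_play X P h" "follows Maker \<sigma> h" "follows Breaker \<tau> h" "length h = k"
      by auto
    then have "card (set h) = k"
      using legal_play_distinct distinct_card by metis
    then have ne: "set h \<noteq> X" using Suc.prems by auto
    have "available X P (set h) (if mover k = Maker then \<sigma> h else \<tau> h)"
      using \<sigma>(1) \<tau>(1) h ne unfolding is_strategy_def mover_def by auto
    then show ?case
      using h by (intro exI[of _ "h @ [if mover k = Maker then \<sigma> h else \<tau> h]"])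
        (auto simp: legal_play_snoc follows_snoc)
  qed
  from this[of "card X"] obtain h where h: "legal_play X P h" "follows Maker \<sigma> h"
    "follows Breaker \<tau> h" "length h = card X" by auto
  then have "set h = X"
    using legal_play_distinct distinct_card legal_play_subset card_subset_eq[OF fin] by metis
  then show False using \<sigma>(2)[of h] \<tau>(2)[of h] h by simp
qed

section \<open>Residual games, and recursive wins turned into strategies\<close>

text \<open>Sets hit by Breaker are dead and dropped; the others shrink by what Maker already owns.
  Maker's success becomes membership of the empty set, and the rest of the history can be
  forgotten.\<close>

definition residual :: "'a set set \<Rightarrow> 'a list \<Rightarrow> 'a set set" where
  "residual F h = (\<lambda>S. S - claimed_by Maker h) ` {S \<in> F. S \<inter> claimed_by Breaker h = {}}"

lemma claimed_by_snoc:
  "claimed_by p (h @ [v]) = (if mover (length h) = p then insert v (claimed_by p h) else claimed_by p h)"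
proof -
  have "{i. i < length (h @ [v]) \<and> mover i = p} =
      (if mover (length h) = p then insert (length h) else id) {i. i < length h \<and> mover i = p}"
    by (auto simp: less_Suc_eq)
  moreover have "(!) (h @ [v]) ` {i. i < length h \<and> mover i = p} = (!) h ` {i. i < length h \<and> mover i = p}"
    by (intro image_cong) (auto simp: nth_append)
  ultimately show ?thesis
    unfolding claimed_by_def setcompr_eq_image by simp
qed

lemma claimed_by_subset: "claimed_by p h \<subseteq> set h"
  by (auto simp: claimed_by_def)

lemma residual_snoc:
  assumes "v \<notin> set h"
  shows "residual F (h @ [v]) =
    (if mover (length h) = Maker then maker_claims v (residual F h) else breaker_claims v (residual F h))"
proof -
  have "v \<notin> claimed_by Maker h" using assms claimed_by_subset[of Maker h] by auto
  moreover have "mover (length h) = Breaker" if "mover (length h) \<noteq> Maker"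
    using that by (cases "mover (length h)") auto
  ultimately show ?thesis
    unfolding residual_def maker_claims_def breaker_claims_def
    by (cases "mover (length h)") (auto simp: claimed_by_snoc image_image Diff_insert[of _ v "claimed_by Maker h"])
qed

text \<open>No vertex occurs twice in the play, so a set completed by Maker is untouched by Breaker
  and is not discarded by the filter in \<open>residual\<close>.\<close>

lemma winner_residual:
  assumes "distinct h"
  shows "winner F h = Maker \<longleftrightarrow> {} \<in> residual F h"
proof -
  have "claimed_by Maker h \<inter> claimed_by Breaker h = {}"
    using assms by (auto simp: claimed_by_def nth_eq_iff_index_eq mover_def)
  moreover have "S \<inter> claimed_by Breaker h = {}" if "S \<subseteq> claimed_by Maker h" for S
    using that calculation by blast
  ultimately show ?thesis
    unfolding winner_def residual_def by auto
qed

lemma available_unblocked: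
  assumes "poset_positional_game X F P" "C \<subseteq> X"
  shows "available X P C v \<longleftrightarrow> unblocked (P - Id) (X - C) v"
proof -
  have "P \<subseteq> X \<times> X"
    using assms by (auto simp: poset_positional_game_def partial_order_on_def preorder_on_def refl_on_def)
  then show ?thesis
    unfolding available_def unblocked_def by auto
qed

context
  fixes X :: "'a set" and F P
  assumes game: "poset_positional_game X F P"
begin

lemma residual_step:
  assumes "legal_play X P h" "available X P (set h) v"
  shows "unblocked (P - Id) (X - set h) v" "legal_play X P (h @ [v])"
    "X - set (h @ [v]) = (X - set h) - {v}"
    "residual F (h @ [v]) =
    (if mover (length h) = Maker then maker_claims v (residual F h) else breaker_claims v (residual F h))"
proof -
  show "unblocked (P - Id) (X - set h) v"
    using assms available_unblocked[OF game legal_play_subset] by blast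
  show "legal_play X P (h @ [v])" using assms by (simp add: legal_play_snoc)
  show "X - set (h @ [v]) = (X - set h) - {v}" by auto
  show "residual F (h @ [v]) =
    (if mover (length h) = Maker then maker_claims v (residual F h) else breaker_claims v (residual F h))"
    using assms(2) by (intro residual_snoc) (simp add: available_def)
qed

lemma mover_Suc: "mover (Suc n) = (if mover n = Maker then Breaker else Maker)"
  by (simp add: mover_def)

text \<open>Supplies the rest of the play, which the early exit \<open>maker_wins.won\<close> omits:
  a move of either player keeps the empty set in the residual family.\<close>

lemma won_forces:
  assumes "legal_play X P h" "{} \<in> residual F h"
  shows "forces X F P Maker h"
  using assms
proof (induction "card (X - set h)" arbitrary: h rule: less_induct)
  case less
  have fin: "finite X" using game by (auto simp: poset_positional_game_def)
  have sub: "set h \<subseteq> X" using less.prems legal_play_subset by blast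
  show ?case
  proof (cases "set h = X")
    case True
    then show ?thesis
      using less.prems winner_residual[OF legal_play_distinct, OF less.prems(1)]
      by (intro forces.over) auto
  next
    case False
    have *: "forces X F P Maker (h @ [v])" if v: "available X P (set h) v" for v
    proof (rule less.hyps)
      show "card (X - set (h @ [v])) < card (X - set h)"
        using v fin by (intro psubset_card_mono) (auto simp: available_def)
      show "legal_play X P (h @ [v])" "{} \<in> residual F (h @ [v])"
        using residual_step(2,4)[OF less.prems(1) v] less.prems(2)
        by (auto simp: maker_claims_def breaker_claims_def image_iff intro: bexI[of _ "{}"])
    qed
    obtain v where "available X P (set h) v"
      using available_exists[OF game, of "set h"] False sub by blast
    with * False show ?thesis
      by (cases "mover (length h) = Maker") (auto intro: forces.own forces.other)
  qed
qed

lemma maker_wins_forces: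
  assumes "maker_wins L p R E" "L = P - Id" "legal_play X P h" "p = mover (length h)"
    "R = X - set h" "E = residual F h"
  shows "forces X F P Maker h"
  using assms
proof (induction arbitrary: h rule: maker_wins.induct)
  case (won E p R)
  then show ?case using won_forces by simp
next
  case (maker R v E)
  have v: "available X P (set h) v"
    using maker available_unblocked[OF game legal_play_subset] by blast
  moreover have "forces X F P Maker (h @ [v])"
    using residual_step[OF maker.prems(2) v] maker.prems by (intro maker.IH) (auto simp: mover_Suc)
  moreover have "set h \<noteq> X" using v by (auto simp: available_def)
  ultimately show ?case using maker.prems by (metis forces.own)
next
  case (breaker R E)
  have "forces X F P Maker (h @ [v])" if v: "available X P (set h) v" for v
    using residual_step[OF breaker.prems(2) v] breaker.prems
    by (intro breaker.IH[of v]) (auto simp: mover_Suc split: if_splits)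
  moreover have "set h \<noteq> X" using breaker.hyps(1) breaker.prems(4) by auto
  moreover have "mover (length h) \<noteq> Maker" using breaker.prems(3) by auto
  ultimately show ?case by (metis forces.other)
qed

lemma breaker_wins_forces:
  assumes "breaker_wins L p R E" "L = P - Id" "legal_play X P h" "p = mover (length h)"
    "R = X - set h" "E = residual F h"
  shows "forces X F P Breaker h"
  using assms
proof (induction arbitrary: h rule: breaker_wins.induct)
  case (over E p)
  then have "set h = X" using legal_play_subset by blast
  moreover have "winner F h \<noteq> Maker"
    using winner_residual[OF legal_play_distinct, OF over.prems(2)] over by simp
  then have "winner F h = Breaker" by (cases "winner F h") auto
  ultimately show ?case by (intro forces.over)
next
  case (breaker R v E)
  have v: "available X P (set h) v"
    using breaker available_unblocked[OF game legal_play_subset] by blast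
  moreover have "forces X F P Breaker (h @ [v])"
    using residual_step[OF breaker.prems(2) v] breaker.prems
    by (intro breaker.IH) (auto simp: mover_Suc split: if_splits)
  moreover have "set h \<noteq> X" using v by (auto simp: available_def)
  ultimately show ?case using breaker.prems by (metis forces.own)
next
  case (maker R E)
  have "forces X F P Breaker (h @ [v])" if v: "available X P (set h) v" for v
    using residual_step[OF maker.prems(2) v] maker.prems
    by (intro maker.IH[of v]) (auto simp: mover_Suc split: if_splits)
  moreover have "set h \<noteq> X" using maker.hyps(1) maker.prems(4) by auto
  moreover have "mover (length h) \<noteq> Breaker" using maker.prems(3) by auto
  ultimately show ?case by (metis forces.other)
qed

lemma residual_Nil: "residual F [] = F"
  by (auto simp: residual_def claimed_by_def)

lemma maker_wins_strategy:
  "maker_wins (P - Id) Maker X F \<Longrightarrow> has_winning_strategy X F P Maker"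
  by (intro forces_winning_strategy[OF game] maker_wins_forces) (auto simp: residual_Nil mover_def)

lemma breaker_wins_strategy:
  "breaker_wins (P - Id) Maker X F \<Longrightarrow> has_winning_strategy X F P Breaker"
  by (intro forces_winning_strategy[OF game] breaker_wins_forces) (auto simp: residual_Nil mover_def)

end

section \<open>Winning for Maker\<close>

inductive_set accessible :: "'a rel \<Rightarrow> 'a set \<Rightarrow> 'a set set \<Rightarrow> 'a set" for L R E where
  unblocked: "unblocked L R v \<Longrightarrow> v \<in> accessible L R E"
| top: "z \<in> accessible L R E \<Longrightarrow> {b, z} \<in> E \<Longrightarrow> b \<noteq> z \<Longrightarrow> b \<in> R \<Longrightarrow> (b, t) \<in> L \<Longrightarrow> t \<in> R \<Longrightarrow>
    t \<in> accessible L R E"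

definition double_threat :: "'a rel \<Rightarrow> 'a set \<Rightarrow> 'a set set \<Rightarrow> bool" where
  "double_threat L R E \<longleftrightarrow> {} \<in> E \<or> (\<exists>v\<in>accessible L R E. {v} \<in> E) \<or>
    (\<exists>v\<in>accessible L R E. \<exists>u\<in>accessible L R E. \<exists>w\<in>accessible L R E.
      v \<noteq> u \<and> v \<noteq> w \<and> u \<noteq> w \<and> {v, u} \<in> E \<and> {v, w} \<in> E)"

text \<open>\<open>p = b\<close> is excluded because Breaker then answers Maker's claim of
  \<open>b\<close> with the top that it frees. Otherwise \<open>p\<close> may be free or a blocked
  top itself.\<close>

definition maker_criterion :: "'a rel \<Rightarrow> 'a set \<Rightarrow> 'a set set \<Rightarrow> bool" where
  "maker_criterion L R E \<longleftrightarrow> double_threat L R E \<or>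
    odd (card R) \<and> ((\<exists>v. {v} \<in> E) \<or> (\<exists>p b t. (b, t) \<in> L \<and> p \<noteq> t \<and> p \<noteq> b \<and> {p, t} \<in> E))"

lemma accessible_subset: "accessible L R E \<subseteq> R"
proof
  show "v \<in> R" if "v \<in> accessible L R E" for v
    using that by induction (auto simp: unblocked_def)
qed

lemma unblocked_mono: "unblocked L R v \<Longrightarrow> R' \<subseteq> R \<Longrightarrow> v \<in> R' \<Longrightarrow> unblocked L R' v"
  by (auto simp: unblocked_def)

lemma unit_wins:
  assumes "unblocked L R v" "{v} \<in> E"
  shows "maker_wins L Maker R E"
proof -
  have "{} \<in> maker_claims v E"
    using assms(2) by (force simp: maker_claims_def)
  then show ?thesis using assms(1) by (blast intro: maker_wins.intros)
qed

lemma two_units_win: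
  assumes "unblocked L R u" "unblocked L R w" "u \<noteq> w" "{u} \<in> E" "{w} \<in> E"
  shows "maker_wins L Breaker R E"
proof (rule maker_wins.breaker)
  show "R \<noteq> {}" using assms(1) by (auto simp: unblocked_def)
next
  fix y assume "unblocked L R y"
  obtain s where s: "unblocked L R s" "{s} \<in> E" "s \<noteq> y" using assms by metis
  then have "unblocked L (R - {y}) s" by (auto simp: unblocked_def)
  moreover have "{s} \<in> breaker_claims y E" using s by (auto simp: breaker_claims_def)
  ultimately show "maker_wins L Maker (R - {y}) (breaker_claims y E)" by (rule unit_wins)
qed

lemma in_maker_claims: "S \<in> E \<Longrightarrow> S - {v} = T \<Longrightarrow> T \<in> maker_claims v E"
  by (auto simp: maker_claims_def)

lemma in_both_claims:
  "S \<in> E \<Longrightarrow> S - {u} = T \<Longrightarrow> v \<notin> T \<Longrightarrow> T \<in> breaker_claims v (maker_claims u E)"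
  by (auto simp: maker_claims_def breaker_claims_def)

lemma both_claimsE:
  assumes "T \<in> breaker_claims v (maker_claims u E)"
  obtains S where "S \<in> E" "T = S - {u}" "v \<notin> T"
  using assms by (auto simp: maker_claims_def breaker_claims_def)

lemma fork_wins:
  assumes "unblocked L R v" "unblocked L R u" "unblocked L R w" "v \<noteq> u" "v \<noteq> w" "u \<noteq> w"
    "{v, u} \<in> E" "{v, w} \<in> E"
  shows "maker_wins L Maker R E"
proof (rule maker_wins.maker)
  show "unblocked L R v" by fact
  show "maker_wins L Breaker (R - {v}) (maker_claims v E)"
  proof (rule two_units_win)
    show "unblocked L (R - {v}) u" "unblocked L (R - {v}) w"
      using assms by (auto simp: unblocked_def)
    show "{u} \<in> maker_claims v E" "{w} \<in> maker_claims v E"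
      using assms(4,5) by (auto intro: in_maker_claims[OF assms(7)] in_maker_claims[OF assms(8)])
  qed fact
qed

text \<open>Claiming \<open>p\<close> leaves the free singleton \<open>{q}\<close>, so every reply
  other than \<open>q\<close> loses at once and only the position after \<open>q\<close> has to be
  examined.\<close>

lemma exchange_wins:
  assumes "unblocked L R p" "unblocked L R q" "p \<noteq> q" "{p, q} \<in> E"
    "maker_wins L Maker (R - {p} - {q}) (breaker_claims q (maker_claims p E))"
  shows "maker_wins L Maker R E"
proof (rule maker_wins.maker[OF assms(1)], rule maker_wins.breaker)
  show "R - {p} \<noteq> {}" using assms by (auto simp: unblocked_def)
  show "maker_wins L Maker (R - {p} - {y}) (breaker_claims y (maker_claims p E))" for y
  proof (cases "y = q")
    case False
    show ?thesis
    proof (rule unit_wins)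
      show "unblocked L (R - {p} - {y}) q" using assms False by (auto simp: unblocked_def)
      show "{q} \<in> breaker_claims y (maker_claims p E)"
        using assms(3,4) False by (intro in_both_claims[of "{p, q}"]) auto
    qed
  qed (use assms in simp)
qed

text \<open>Going back to the earliest use of \<open>top\<close> in the derivation finds a pair with
  both ends free, because bottoms are always free. So an accessible blocked vertex always offers
  Maker a forcing exchange.\<close>

lemma accessible_blocked:
  assumes "v \<in> accessible L R E" "\<not> unblocked L R v"
    and bottom: "\<And>b t. (b, t) \<in> L \<Longrightarrow> b \<in> R \<Longrightarrow> unblocked L R b"
  shows "\<exists>b z. unblocked L R b \<and> unblocked L R z \<and> b \<noteq> z \<and> {b, z} \<in> E"
  using assms(1,2) by induction (auto intro: bottom)

section \<open>Double threats on chains of height at most two\<close>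

text \<open>Only the strict order is fixed: play shrinks the board while the order stays the
  same.\<close>

locale two_level =
  fixes L :: "'a rel"
  assumes below_unique: "(a, t) \<in> L \<Longrightarrow> (b, t) \<in> L \<Longrightarrow> a = b"
    and above_unique: "(b, s) \<in> L \<Longrightarrow> (b, t) \<in> L \<Longrightarrow> s = t"
    and height: "(a, b) \<in> L \<Longrightarrow> (b, c) \<notin> L"
begin

lemma bottom_unblocked: "(b, t) \<in> L \<Longrightarrow> b \<in> R \<Longrightarrow> unblocked L R b"
  using height by (auto simp: unblocked_def)

lemma blockedE:
  assumes "v \<in> R" "\<not> unblocked L R v"
  obtains b where "(b, v) \<in> L" "b \<in> R" "unblocked L R b"
  using assms bottom_unblocked by (auto simp: unblocked_def)

lemma top_unblocked: "(b, t) \<in> L \<Longrightarrow> t \<in> R \<Longrightarrow> b \<notin> R \<Longrightarrow> unblocked L R t"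
  unfolding unblocked_def using below_unique by blast

text \<open>The exchange can only disturb derivation steps through \<open>p\<close> or
  \<open>q\<close>. If \<open>b\<close> is one of them, its top is now simply unblocked. If
  \<open>z\<close> is one of them, then \<open>{b, z}\<close> and \<open>{p, q}\<close> form a fork
  of free vertices, which \<open>no_fork\<close> excludes.\<close>

lemma accessible_exchange:
  assumes pq: "unblocked L R p" "unblocked L R q" "p \<noteq> q" "{p, q} \<in> E"
    and no_fork: "\<And>v u w. unblocked L R v \<Longrightarrow> unblocked L R u \<Longrightarrow> unblocked L R w \<Longrightarrow>
      v \<noteq> u \<Longrightarrow> v \<noteq> w \<Longrightarrow> {v, u} \<in> E \<Longrightarrow> {v, w} \<in> E \<Longrightarrow> u = w"
    and "v \<in> accessible L R E" "v \<noteq> p" "v \<noteq> q"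
  shows "v \<in> accessible L (R - {p} - {q}) (breaker_claims q (maker_claims p E))"
  using assms(6-)
proof induction
  case (unblocked v)
  then show ?case
    by (intro accessible.unblocked) (auto simp: unblocked_def)
next
  case (top z b t)
  show ?case
  proof (cases "b = p \<or> b = q")
    case True
    then show ?thesis
      using top by (intro accessible.unblocked top_unblocked[of b]) auto
  next
    case b: False
    have "unblocked L R b" "{z, b} \<in> E" "{q, p} \<in> E"
      using top pq bottom_unblocked by (auto simp: insert_commute)
    then have "z \<noteq> p \<and> z \<noteq> q"
      using no_fork[of p b q] no_fork[of q b p] pq b by blast
    moreover from this have "{b, z} \<in> breaker_claims q (maker_claims p E)"
      using b top by (intro in_both_claims[of "{b, z}"]) auto
    ultimately show ?thesis
      using top b by - (rule accessible.top[where z = z and b = b], auto)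
  qed
qed

text \<open>If Maker has no immediate win, some vertex of the double threat is blocked, which yields
  a free pair to exchange. A pair disjoint from the threat leaves it intact on a smaller board. A
  pair that meets a fork is played from the shared end, which turns a branch of the fork into an
  accessible singleton.\<close>

lemma double_threat_wins:
  assumes "finite R" "double_threat L R E"
  shows "maker_wins L Maker R E"
  using assms
proof (induction "card R" arbitrary: R E rule: less_induct)
  case less
  show ?case
  proof (rule ccontr)
    assume lost: "\<not> maker_wins L Maker R E"
    have no_unit: "\<not> unblocked L R v" if "{v} \<in> E" for v
      using lost unit_wins[OF _ that] by blast
    have no_fork: "u = w" if "unblocked L R v" "unblocked L R u" "unblocked L R w"
      "v \<noteq> u" "v \<noteq> w" "{v, u} \<in> E" "{v, w} \<in> E" for v u w
      using lost fork_wins[OF that(1-5) _ that(6,7)] by blast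
    let ?A = "accessible L R E"
    have exch: "\<not> double_threat L (R - {p} - {q}) (breaker_claims q (maker_claims p E))"
      if "unblocked L R p" "unblocked L R q" "p \<noteq> q" "{p, q} \<in> E" for p q
    proof
      assume "double_threat L (R - {p} - {q}) (breaker_claims q (maker_claims p E))"
      moreover have "card (R - {p} - {q}) < card R"
        using that less.prems by (intro psubset_card_mono) (auto simp: unblocked_def)
      ultimately have "maker_wins L Maker (R - {p} - {q}) (breaker_claims q (maker_claims p E))"
        using less.prems(1) by (intro less.hyps) auto
      with exchange_wins[OF that] lost show False by blast
    qed
    \<comment> \<open>\<open>T\<close> is either a singleton already or a pair containing
      \<open>p\<close>; both uses occur below.\<close>
    have no_unit': "T - {p} \<noteq> {x}" if "unblocked L R p" "unblocked L R q" "p \<noteq> q" "{p, q} \<in> E"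
      "x \<in> ?A" "x \<noteq> p" "x \<noteq> q" "T \<in> E" for p q x T
    proof
      assume "T - {p} = {x}"
      then have "{x} \<in> breaker_claims q (maker_claims p E)"
        using that by (intro in_both_claims[of T]) auto
      moreover have "x \<in> accessible L (R - {p} - {q}) (breaker_claims q (maker_claims p E))"
        by (rule accessible_exchange[OF that(1-4) _ that(5-7)]) (fact no_fork)
      ultimately show False
        using exch[OF that(1-4)] unfolding double_threat_def by blast
    qed
    have "{} \<notin> E" using lost maker_wins.won by blast
    then consider (unit) v where "v \<in> ?A" "{v} \<in> E"
      | (fork) v u w where "v \<in> ?A" "u \<in> ?A" "w \<in> ?A" "v \<noteq> u" "v \<noteq> w" "u \<noteq> w"
          "{v, u} \<in> E" "{v, w} \<in> E"
      using less.prems(2) unfolding double_threat_def by blast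
    then show False
    proof cases
      case unit
      then obtain b z where bz: "unblocked L R b" "unblocked L R z" "b \<noteq> z" "{b, z} \<in> E"
        using accessible_blocked[OF unit(1)] no_unit bottom_unblocked by metis
      with unit no_unit have "v \<noteq> b" "v \<noteq> z" by auto
      with no_unit'[OF bz, of v "{v}"] unit show False by auto
    next
      case fork
      then have "\<not> unblocked L R v \<or> \<not> unblocked L R u \<or> \<not> unblocked L R w"
        using no_fork by blast
      then obtain b z where bz: "unblocked L R b" "unblocked L R z" "b \<noteq> z" "{b, z} \<in> E"
        using accessible_blocked fork(1-3) bottom_unblocked by metis
      then have zb: "unblocked L R z" "unblocked L R b" "z \<noteq> b" "{z, b} \<in> E"
        by (auto simp: insert_commute)
      \<comment> \<open>\<open>q\<close> coincides with at most one of \<open>u\<close> and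
        \<open>w\<close>; the other branch shrinks to a singleton.\<close>
      have center: False if "unblocked L R v" "unblocked L R q" "v \<noteq> q" "{v, q} \<in> E" for q
        using no_unit'[OF that, of u "{v, u}"] no_unit'[OF that, of w "{v, w}"] fork by auto
      have leaf: False if "unblocked L R x" "unblocked L R q" "x \<noteq> q" "{x, q} \<in> E"
        "x = u \<or> x = w" "v \<noteq> q" for x q
        using no_unit'[OF that(1-4), of v "{v, x}"] that(5,6) fork by auto
      consider "v = b" | "v = z" | "v \<noteq> b" "v \<noteq> z" "b = u \<or> b = w" | "v \<noteq> b" "v \<noteq> z" "z = u \<or> z = w"
        | "{v, u, w} \<inter> {b, z} = {}" by blast
      then show False
      proof cases
        case 1 then show ?thesis using center bz by blast
      next
        case 2 then show ?thesis using center zb by blast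
      next
        case 3 then show ?thesis using leaf bz by blast
      next
        case 4 then show ?thesis using leaf zb by blast
      next
        case 5
        let ?E = "breaker_claims z (maker_claims b E)"
        have "x \<in> accessible L (R - {b} - {z}) ?E" if "x \<in> {v, u, w}" for x
          by (rule accessible_exchange[OF bz], fact no_fork) (use that 5 fork in auto)
        moreover have "{v, u} \<in> ?E"
          using 5 fork by (intro in_both_claims[of "{v, u}"]) auto
        moreover have "{v, w} \<in> ?E"
          using 5 fork by (intro in_both_claims[of "{v, w}"]) auto
        ultimately have "double_threat L (R - {b} - {z}) ?E"
          unfolding double_threat_def using fork(4-6) by blast
        then show False using exch[OF bz] by blast
      qed
    qed
  qed
qed

section \<open>Maker's waiting moves on odd boards\<close>

lemma odd_step:
  assumes "finite R" "odd (card R)" "x \<in> R" "y \<in> R" "x \<noteq> y"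
  shows "finite (R - {x} - {y})" "odd (card (R - {x} - {y}))" "card (R - {x} - {y}) < card R"
proof -
  have "card R = Suc (Suc (card (R - {x} - {y})))"
    using assms(1,3-5) by (metis DiffI card.remove finite_Diff singletonD)
  then show "finite (R - {x} - {y})" "odd (card (R - {x} - {y}))" "card (R - {x} - {y}) < card R"
    using assms by auto
qed

text \<open>\<open>C\<close> is a union of chains, so the bottom of a blocked vertex outside
  \<open>C\<close> is outside as well. This provides Maker's waiting moves.\<close>

lemma unblocked_outside:
  assumes "x \<in> R" "\<And>b t. (b, t) \<in> L \<Longrightarrow> b \<in> C \<longleftrightarrow> t \<in> C" "x \<notin> C"
  shows "\<exists>v. unblocked L R v \<and> v \<notin> C"
  using assms blockedE by metis

lemma top_unit_wins_odd:
  assumes "finite R" "odd (card R)" "(b, t) \<in> L" "b \<in> R" "t \<in> R" "{t} \<in> E"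
  shows "maker_wins L Maker R E"
  using assms
proof (induction "card R" arbitrary: R E rule: less_induct)
  case less
  have "b \<noteq> t" using less.prems height by blast
  \<comment> \<open>Parity takes the place of a base case: an odd board is never just this chain, so
    Maker has a waiting move at each of her turns.\<close>
  have "\<not> R \<subseteq> {b, t}"
  proof
    assume "R \<subseteq> {b, t}"
    then have "R = {b, t}" using less.prems by auto
    then show False using less.prems(2) \<open>b \<noteq> t\<close> by simp
  qed
  then obtain x0 where "x0 \<in> R" "x0 \<notin> {b, t}" by auto
  then obtain x where x: "unblocked L R x" "x \<notin> {b, t}"
    using unblocked_outside[of x0 R "{b, t}"] less.prems(3) below_unique above_unique height by blast
  have xR: "x \<in> R" using x by (simp add: unblocked_def)
  show ?case
  proof (rule maker_wins.maker[OF x(1)], rule maker_wins.breaker)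
    show "R - {x} \<noteq> {}" using less.prems x by auto
    fix y assume y: "unblocked L (R - {x}) y"
    then have yR: "y \<in> R" "x \<noteq> y" "y \<noteq> t" using less.prems x by (auto simp: unblocked_def)
    have unit: "{t} \<in> breaker_claims y (maker_claims x E)"
      using less.prems(6) x yR by (intro in_both_claims[of "{t}"]) auto
    show "maker_wins L Maker (R - {x} - {y}) (breaker_claims y (maker_claims x E))"
    proof (cases "y = b")
      case True
      then show ?thesis
        using unit less.prems x yR by (intro unit_wins[of _ _ t] top_unblocked[of b]) auto
    next
      case False
      then show ?thesis
        using odd_step[OF less.prems(1,2) xR yR(1,2)] unit less.prems x yR
        by (intro less.hyps) auto
    qed
  qed
qed

text \<open>Claiming \<open>x\<close> creates \<open>{t}\<close>. Breaker either frees
  \<open>t\<close> at once or leaves an odd board to which the waiting argument applies.\<close>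

lemma top_edge_wins_odd:
  assumes "finite R" "odd (card R)" "(b, t) \<in> L" "b \<in> R" "t \<in> R" "{x, t} \<in> E"
    "unblocked L R x" "x \<noteq> b"
  shows "maker_wins L Maker R E"
proof (rule maker_wins.maker[OF assms(7)], rule maker_wins.breaker)
  have xR: "x \<in> R" "x \<noteq> t" using assms by (auto simp: unblocked_def)
  show "R - {x} \<noteq> {}" using assms by auto
  fix y assume y: "unblocked L (R - {x}) y"
  then have yR: "y \<in> R" "x \<noteq> y" "y \<noteq> t" using assms by (auto simp: unblocked_def)
  have unit: "{t} \<in> breaker_claims y (maker_claims x E)"
    using assms(6) xR yR by (intro in_both_claims[of "{x, t}"]) auto
  show "maker_wins L Maker (R - {x} - {y}) (breaker_claims y (maker_claims x E))"
  proof (cases "y = b")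
    case True
    then show ?thesis
      using unit assms xR yR by (intro unit_wins[of _ _ t] top_unblocked[of b]) auto
  next
    case False
    then show ?thesis
      using odd_step[OF assms(1,2) xR(1) yR(1,2)] unit assms xR yR
      by (intro top_unit_wins_odd[of _ b t]) auto
  qed
qed

text \<open>Neither end can be claimed yet, so Maker waits outside both chains, whose four vertices
  cannot be an odd board. Once Breaker takes one of the bottoms, the freed top serves as the free
  end of the pair.\<close>

lemma two_tops_edge_wins_odd:
  assumes "finite R" "odd (card R)" "(b, t) \<in> L" "b \<in> R" "t \<in> R"
    "(b', t') \<in> L" "b' \<in> R" "t' \<in> R" "t \<noteq> t'" "{t, t'} \<in> E"
  shows "maker_wins L Maker R E"
  using assms
proof (induction "card R" arbitrary: R E rule: less_induct)
  case less
  let ?C = "{b, t, b', t'}"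
  have ne: "b \<noteq> b'" "b \<noteq> t" "b' \<noteq> t'" "b \<noteq> t'" "b' \<noteq> t"
    using less.prems height above_unique by blast+
  have "\<not> R \<subseteq> ?C"
  proof
    assume "R \<subseteq> ?C"
    then have "R = ?C" using less.prems by auto
    then show False using less.prems(2,9) ne by simp
  qed
  then obtain x0 where "x0 \<in> R" "x0 \<notin> ?C" by auto
  then obtain x where x: "unblocked L R x" "x \<notin> ?C"
    using unblocked_outside[of x0 R ?C] less.prems(3,6) below_unique above_unique height by blast
  have xR: "x \<in> R" using x by (simp add: unblocked_def)
  show ?case
  proof (rule maker_wins.maker[OF x(1)], rule maker_wins.breaker)
    show "R - {x} \<noteq> {}" using less.prems x by auto
    fix y assume y: "unblocked L (R - {x}) y"
    then have yR: "y \<in> R" "x \<noteq> y" "y \<noteq> t" "y \<noteq> t'"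
      using less.prems x by (auto simp: unblocked_def)
    have edge: "{t, t'} \<in> breaker_claims y (maker_claims x E)"
      using less.prems(10) x yR by (intro in_both_claims[of "{t, t'}"]) auto
    note step = odd_step[OF less.prems(1,2) xR yR(1,2)]
    consider "y = b" | "y = b'" | "y \<noteq> b" "y \<noteq> b'" by blast
    then show "maker_wins L Maker (R - {x} - {y}) (breaker_claims y (maker_claims x E))"
    proof cases
      case 1
      then show ?thesis
        using step edge less.prems x yR ne
        by (intro top_edge_wins_odd[of _ b' t' t] top_unblocked[of b t]) auto
    next
      case 2
      then show ?thesis
        using step edge less.prems x yR ne
        by (intro top_edge_wins_odd[of _ b t t'] top_unblocked[of b' t']) (auto simp: insert_commute)
    next
      case 3
      then show ?thesis
        using step edge less.prems x yR by (intro less.hyps) auto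
    qed
  qed
qed

lemma maker_criterion_wins:
  assumes "finite R" "L \<subseteq> R \<times> R" "E \<subseteq> Pow R" "maker_criterion L R E"
  shows "maker_wins L Maker R E"
proof (cases "double_threat L R E")
  case True
  then show ?thesis using assms(1) double_threat_wins by blast
next
  case False
  then have odd: "odd (card R)" and "(\<exists>v. {v} \<in> E) \<or> (\<exists>p b t. (b, t) \<in> L \<and> p \<noteq> t \<and> p \<noteq> b \<and> {p, t} \<in> E)"
    using assms(4) by (auto simp: maker_criterion_def)
  then consider v where "{v} \<in> E" | p b t where "(b, t) \<in> L" "p \<noteq> t" "p \<noteq> b" "{p, t} \<in> E"
    by blast
  then show ?thesis
  proof cases
    case 1
    then have "v \<in> R" using assms by auto
    then show ?thesis
      using 1 unit_wins top_unit_wins_odd[OF assms(1) odd] blockedE by metis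
  next
    case 2
    then have R: "b \<in> R" "t \<in> R" "p \<in> R" using assms by auto
    show ?thesis
    proof (cases "unblocked L R p")
      case True
      then show ?thesis using top_edge_wins_odd[OF assms(1) odd] 2 R by blast
    next
      case False
      then obtain b' where "(b', p) \<in> L" "b' \<in> R" using R blockedE by blast
      then show ?thesis using two_tops_edge_wins_odd[OF assms(1) odd _ _ _ _ _ _ 2(2,4)] 2 R by blast
    qed
  qed
qed

end

section \<open>Winning for Breaker\<close>

context two_level begin

section \<open>Breaker's answers on even boards\<close>

text \<open>Either end of an accessible pair can be the bottom in the rule \<open>top\<close>; hence
  claiming an end frees nothing that was not accessible before.\<close>

lemma accessible_neighbour:
  assumes "a \<in> accessible L R E" "b \<in> accessible L R E" "{a, b} \<in> E" "a \<noteq> b"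
    "(a, t) \<in> L" "t \<in> R"
  shows "t \<in> accessible L R E"
  using assms accessible_subset[of L R E] by (intro accessible.top[OF assms(2,3)]) auto

text \<open>Common core of Breaker's replies: \<open>B\<close> bounds what is accessible after the
  round, and its closure is checked against the old family only. The condition on
  \<open>{u, z}\<close> keeps Maker's claim from creating a singleton inside
  \<open>B\<close>.\<close>

lemma no_double_threat_reply:
  assumes "finite R" "E \<subseteq> Pow R" "\<And>S. S \<in> E \<Longrightarrow> card S \<le> 2" "\<not> double_threat L R E"
    and "u \<in> accessible L R E" "B \<subseteq> accessible L R E" "u \<notin> B" "\<And>z. z \<in> B \<Longrightarrow> {u, z} \<notin> E"
    and start: "\<And>x. unblocked L (R - {u} - {v}) x \<Longrightarrow> x \<in> B"
    and step: "\<And>z b t. z \<in> B \<Longrightarrow> {b, z} \<in> E \<Longrightarrow> b \<noteq> z \<Longrightarrow> b \<in> R - {u} - {v} \<Longrightarrow> (b, t) \<in> L \<Longrightarrow>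
      t \<in> R - {u} - {v} \<Longrightarrow> t \<in> B"
  shows "\<not> double_threat L (R - {u} - {v}) (breaker_claims v (maker_claims u E))"
proof
  let ?R = "R - {u} - {v}" and ?E = "breaker_claims v (maker_claims u E)"
  \<comment> \<open>A pair left over from a set containing \<open>u\<close> would come from a set of
    three elements.\<close>
  have pair: "{a, b} \<in> E" if ab: "{a, b} \<in> ?E" "a \<noteq> b" for a b
  proof -
    obtain S where S: "S \<in> E" "{a, b} = S - {u}" using ab(1) by (rule both_claimsE)
    have "finite S" using S(1) assms(1,2) finite_subset by blast
    have "u \<notin> S"
    proof
      assume "u \<in> S"
      then have "S = insert u {a, b}" "u \<notin> {a, b}" using S(2) by auto
      then have "card S = 3" using ab(2) by simp
      then show False using assms(3)[OF S(1)] by simp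
    qed
    then show ?thesis using S by simp
  qed
  have sub: "x \<in> B" if "x \<in> accessible L ?R ?E" for x
    using that
  proof induction
    case (unblocked x)
    then show ?case by (rule start)
  next
    case (top z b t)
    then show ?case using step[of z b t] pair[of b z] by blast
  qed
  assume "double_threat L ?R ?E"
  then consider "{} \<in> ?E" | x where "x \<in> accessible L ?R ?E" "{x} \<in> ?E"
    | x y z where "x \<in> accessible L ?R ?E" "y \<in> accessible L ?R ?E" "z \<in> accessible L ?R ?E"
        "x \<noteq> y" "x \<noteq> z" "y \<noteq> z" "{x, y} \<in> ?E" "{x, z} \<in> ?E"
    unfolding double_threat_def by blast
  then show False
  proof cases
    case 1
    then obtain S where "S \<in> E" "S \<subseteq> {u}" by (auto elim!: both_claimsE)
    then have "S = {} \<or> S = {u}" by auto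
    then show False using \<open>S \<in> E\<close> assms(4,5) unfolding double_threat_def by auto
  next
    case 2
    then have x: "x \<in> B" "x \<noteq> u" using sub assms(7) by auto
    obtain S where "S \<in> E" "{x} = S - {u}" using 2(2) by (rule both_claimsE)
    then have "S = {x} \<or> S = {u, x}" by auto
    then show False using \<open>S \<in> E\<close> assms(4,6,8) x unfolding double_threat_def by auto
  next
    case 3
    then have "{x, y} \<in> E" "{x, z} \<in> E" using pair by auto
    moreover have "x \<in> accessible L R E" "y \<in> accessible L R E" "z \<in> accessible L R E"
      using 3 sub assms(6) by auto
    ultimately show False using 3(4-6) assms(4) unfolding double_threat_def by blast
  qed
qed

lemma accessible_unique:
  assumes "\<not> double_threat L R E" "v \<in> accessible L R E" "u \<in> accessible L R E" "w \<in> accessible L R E"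
    "{v, u} \<in> E" "{v, w} \<in> E" "v \<noteq> u" "v \<noteq> w"
  shows "u = w"
  using assms unfolding double_threat_def by blast

text \<open>When Maker's move \<open>u\<close> calls for an answer at \<open>w\<close> but \<open>w\<close> is a blocked top, Breaker gives up
  \<open>w\<close> by claiming instead the partner of the bottom of \<open>w\<close>; if that partner is again a blocked top,
  the step is repeated. \<open>D\<close> is the resulting chain of tops, ending in the unblocked vertex \<open>v\<close>.\<close>

definition retreat :: "'a set \<Rightarrow> 'a set set \<Rightarrow> 'a \<Rightarrow> 'a \<Rightarrow> 'a set \<Rightarrow> 'a \<Rightarrow> bool" where
  "retreat R E u w D v \<longleftrightarrow> w \<in> D \<and> D \<subseteq> accessible L R E - {u} \<and> v \<in> D \<and> unblocked L (R - {u}) v \<and>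
    (\<forall>d\<in>D. unblocked L (R - {u}) d \<longrightarrow> d = v) \<and>
    (\<forall>t\<in>D. \<forall>b\<in>R - {u}. \<forall>z\<in>accessible L R E. (b, t) \<in> L \<longrightarrow> {b, z} \<in> E \<longrightarrow> z \<noteq> b \<longrightarrow> z \<in> D) \<and>
    (\<forall>d\<in>D. d = w \<or> (\<exists>b\<in>R - {u}. \<exists>t\<in>D. (b, t) \<in> L \<and> {b, d} \<in> E \<and> b \<noteq> d))"

lemma retreat_unblocked:
  assumes "w \<in> accessible L R E" "w \<noteq> u" "unblocked L (R - {u}) w"
  shows "retreat R E u w {w} w"
  using assms unfolding retreat_def by (auto simp: unblocked_def)

text \<open>Induction along the derivation of \<open>w\<close>. A blocked \<open>w\<close> owes its
  accessibility to a pair \<open>{b, z}\<close> below it, so giving up \<open>w\<close> means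
  denying \<open>z\<close> to Maker, and the task passes to \<open>z\<close>, which was derived
  earlier. It ends at a vertex that is free once \<open>u\<close> is gone.\<close>

lemma retreat_exists:
  assumes "\<not> double_threat L R E" "w \<in> accessible L R E" "w \<noteq> u"
    and "\<And>x. unblocked L R x \<Longrightarrow> {u, x} \<in> E \<Longrightarrow> x = u"
  shows "\<exists>D v. retreat R E u w D v"
  using assms(2,3)
proof induction
  case (unblocked w)
  then have "unblocked L (R - {u}) w" by (auto simp: unblocked_def)
  then show ?case using unblocked accessible.unblocked[of L R w E] retreat_unblocked by blast
next
  case (top z b t)
  have t: "t \<in> accessible L R E" using accessible.top[OF top(1-6)] by simp
  show ?case
  proof (cases "b = u")
    case True
    then have "unblocked L (R - {u}) t" using top by (intro top_unblocked[of b]) auto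
    then show ?thesis using t top retreat_unblocked by blast
  next
    case False
    have bA: "b \<in> accessible L R E" using bottom_unblocked top accessible.unblocked by metis
    \<comment> \<open>Otherwise the free bottom \<open>b\<close> would be an unblocked partner of
      \<open>u\<close>.\<close>
    have "z \<noteq> u"
      using assms(4)[of b] top False bottom_unblocked[of b t R] by (auto simp: insert_commute)
    then obtain D v where D: "retreat R E u z D v" using top by blast
    have D': "D \<subseteq> accessible L R E - {u}" "v \<in> D" "unblocked L (R - {u}) v"
        "\<forall>d\<in>D. unblocked L (R - {u}) d \<longrightarrow> d = v"
      using D unfolding retreat_def by - (elim conjE; assumption)+
    have blocked: "\<not> unblocked L (R - {u}) t" using top False by (auto simp: unblocked_def)
    \<comment> \<open>By the matching property \<open>z\<close> is the only accessible partner of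
      the bottom of \<open>t\<close>, so adding \<open>t\<close> imposes no further closure
      condition.\<close>
    have uniq: "z' = z" if "(b', t) \<in> L" "z' \<in> accessible L R E" "{b', z'} \<in> E" "z' \<noteq> b'" for b' z'
      using that below_unique[OF that(1) top(5)] accessible_unique[OF assms(1) bA, of z' z] top by auto
    have origin: "\<exists>b\<in>R - {u}. \<exists>t\<in>insert t D. (b, t) \<in> L \<and> {b, d} \<in> E \<and> b \<noteq> d" if d: "d \<in> D" for d
    proof (cases "d = z")
      case True
      have "b \<in> R - {u}" using top False by simp
      then show ?thesis using True top by (intro bexI[of _ b] bexI[of _ t]) auto
    next
      case False
      then have "\<exists>b\<in>R - {u}. \<exists>t\<in>D. (b, t) \<in> L \<and> {b, d} \<in> E \<and> b \<noteq> d"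
        using D d unfolding retreat_def by (elim conjE) blast
      then show ?thesis by blast
    qed
    have partner: "z' \<in> insert t D" if *: "t' \<in> insert t D" "b' \<in> R - {u}" "z' \<in> accessible L R E"
      "(b', t') \<in> L" "{b', z'} \<in> E" "z' \<noteq> b'" for t' b' z'
    proof (cases "t' = t")
      case True
      then show ?thesis using uniq[of b' z'] * D by (simp add: retreat_def)
    next
      case False
      then show ?thesis using D * unfolding retreat_def by (elim conjE) blast
    qed
    have "retreat R E u t (insert t D) v"
      unfolding retreat_def
      apply (intro conjI ballI impI)
            apply simp
      subgoal using D'(1) t top.prems by blast
      subgoal using D'(2) by simp
      subgoal by (rule D'(3))
      subgoal for d using D'(4) blocked by (cases "d = t") simp_all
      subgoal by (rule partner)
      subgoal for d using origin[of d] by (cases "d = t") simp_all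
      done
    then show ?thesis by blast
  qed
qed

text \<open>Breaker's claim of \<open>v\<close> cuts all of \<open>D\<close> off: a derivation of a
  member of \<open>D\<close> would have to start from a partner in \<open>D\<close>, and
  \<open>v\<close>, the only free vertex of \<open>D\<close>, is gone. So the singleton
  \<open>{w}\<close> left by Maker is harmless even if \<open>w\<close> is still on the
  board.\<close>

lemma even_answer:
  assumes fin: "finite R" and E: "E \<subseteq> Pow R" "\<And>S. S \<in> E \<Longrightarrow> card S \<le> 2"
    and nd: "\<not> double_threat L R E" and u: "unblocked L R u"
    and w: "w \<in> accessible L R E" "{u, w} \<in> E" "u \<noteq> w"
  shows "\<exists>v. unblocked L (R - {u}) v \<and>
    \<not> double_threat L (R - {u} - {v}) (breaker_claims v (maker_claims u E))"
proof -
  let ?A = "accessible L R E"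
  have uA: "u \<in> ?A" using u by (rule accessible.unblocked)
  have uniq: "z = w" if "z \<in> ?A" "{u, z} \<in> E" "u \<noteq> z" for z
    using accessible_unique[OF nd uA that(1) w(1) that(2) w(2)] that w by auto
  have "\<exists>D v. retreat R E u w D v"
  proof (cases "unblocked L (R - {u}) w")
    case True
    then show ?thesis using retreat_unblocked[OF w(1) _ True] w(3) by blast
  next
    case False
    have "x = u" if "unblocked L R x" "{u, x} \<in> E" for x
    proof (rule ccontr)
      assume "x \<noteq> u"
      then have "x = w" using uniq that accessible.unblocked by metis
      then show False using that False \<open>x \<noteq> u\<close> by (auto simp: unblocked_def)
    qed
    then show ?thesis using retreat_exists nd w by metis
  qed
  then obtain D v where retreat: "retreat R E u w D v" by blast
  have D: "w \<in> D" "D \<subseteq> ?A - {u}" "v \<in> D" and v: "unblocked L (R - {u}) v"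
    using retreat unfolding retreat_def by - (elim conjE; assumption)+
  have last: "\<And>d. d \<in> D \<Longrightarrow> unblocked L (R - {u}) d \<Longrightarrow> d = v"
    using retreat unfolding retreat_def by (elim conjE) blast
  have partner: "\<And>t b z. t \<in> D \<Longrightarrow> b \<in> R - {u} \<Longrightarrow> z \<in> ?A \<Longrightarrow> (b, t) \<in> L \<Longrightarrow> {b, z} \<in> E \<Longrightarrow> z \<noteq> b \<Longrightarrow> z \<in> D"
    using retreat unfolding retreat_def by (elim conjE) blast
  have origin: "\<And>d. d \<in> D \<Longrightarrow> d = w \<or> (\<exists>b\<in>R - {u}. \<exists>t\<in>D. (b, t) \<in> L \<and> {b, d} \<in> E \<and> b \<noteq> d)"
    using retreat unfolding retreat_def by (elim conjE) blast
  \<comment> \<open>Claiming \<open>v\<close> must not free a member of \<open>D\<close>. If it did,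
    closure would put the partner of \<open>v\<close> into \<open>D\<close>; but this partner is
    \<open>u\<close> or a free bottom other than \<open>v\<close>, and \<open>D\<close> contains
    neither.\<close>
  have v_not_bottom: "x \<notin> D" if "(v, x) \<in> L" for x
  proof
    assume x: "x \<in> D"
    have vR: "v \<in> R - {u}" using v by (auto simp: unblocked_def)
    show False
    proof (cases "v = w")
      case True
      then have "u \<in> D"
        using partner[OF x vR uA that] w by (auto simp: insert_commute)
      then show False using D by auto
    next
      case False
      then obtain b t where b: "b \<in> R - {u}" "t \<in> D" "(b, t) \<in> L" "{b, v} \<in> E" "b \<noteq> v"
        using origin D by blast
      then have "unblocked L R b" "unblocked L (R - {u}) b" using bottom_unblocked by blast+
      then have "b \<in> ?A" by (blast intro: accessible.unblocked)
      then have "b \<in> D" using partner[OF x vR _ that, of b] b by (auto simp: insert_commute)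
      then show False using last b \<open>unblocked L (R - {u}) b\<close> by blast
    qed
  qed
  have vA: "v \<in> ?A" using D by auto
  \<comment> \<open>With an accessible partner for \<open>v\<close>, the top that \<open>v\<close>
    may free was accessible already.\<close>
  obtain v' where v': "v' \<in> ?A" "{v, v'} \<in> E" "v \<noteq> v'"
  proof (cases "v = w")
    case True
    then show ?thesis using that uA w by (metis insert_commute)
  next
    case False
    then obtain b t where b: "b \<in> R - {u}" "(b, t) \<in> L" "{b, v} \<in> E" "b \<noteq> v"
      using origin D by blast
    then have "b \<in> ?A" using bottom_unblocked accessible.unblocked by (metis DiffD1)
    then show ?thesis using that b by (metis insert_commute)
  qed
  have "\<not> double_threat L (R - {u} - {v}) (breaker_claims v (maker_claims u E))"
  proof (rule no_double_threat_reply[OF fin E nd uA, where B = "?A - D - {u}"])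
    fix x assume x: "unblocked L (R - {u} - {v}) x"
    then have xR: "x \<in> R" "x \<noteq> u" "x \<noteq> v" by (auto simp: unblocked_def)
    have "x \<in> ?A"
    proof (cases "unblocked L R x")
      case True
      then show ?thesis by (rule accessible.unblocked)
    next
      case False
      then obtain a where a: "(a, x) \<in> L" "a \<in> R" using xR blockedE by blast
      then have "a = u \<or> a = v" using x by (auto simp: unblocked_def)
      then show ?thesis
        using accessible_neighbour[OF uA w(1,2,3), of x] accessible_neighbour[OF vA v', of x] a xR by blast
    qed
    moreover have "x \<notin> D"
    proof
      assume "x \<in> D"
      then have "\<not> unblocked L (R - {u}) x" using last xR by blast
      then obtain a where a: "(a, x) \<in> L" "a \<in> R - {u}"
        using xR blockedE[of x "R - {u}"] by auto
      then have "a = v" using x by (auto simp: unblocked_def)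
      then show False using v_not_bottom a \<open>x \<in> D\<close> by blast
    qed
    ultimately show "x \<in> ?A - D - {u}" using xR by blast
  next
    fix z b t
    assume z: "z \<in> ?A - D - {u}" "{b, z} \<in> E" "b \<noteq> z" "b \<in> R - {u} - {v}" "(b, t) \<in> L"
      "t \<in> R - {u} - {v}"
    then have "t \<in> ?A" by (intro accessible.top[of z L R E b t]) auto
    moreover have "t \<notin> D"
    proof
      assume "t \<in> D"
      then have "z \<in> D" using partner[of t b z] z by auto
      then show False using z by blast
    qed
    ultimately show "t \<in> ?A - D - {u}" using z by blast
  next
    show "{u, z} \<notin> E" if "z \<in> ?A - D - {u}" for z
      using uniq[of z] that D by auto
  qed auto
  then show ?thesis using v by blast
qed

text \<open>\<open>u\<close> and \<open>t\<close> are a whole chain, so nothing else is unblocked by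
  their removal.\<close>

lemma even_quiet_chain:
  assumes fin: "finite R" and E: "E \<subseteq> Pow R" "\<And>S. S \<in> E \<Longrightarrow> card S \<le> 2"
    and nd: "\<not> double_threat L R E" and u: "unblocked L R u"
    and w: "\<And>w. w \<in> accessible L R E \<Longrightarrow> {u, w} \<in> E \<Longrightarrow> u = w"
    and t: "(u, t) \<in> L" "t \<in> R"
  shows "\<not> double_threat L (R - {u} - {t}) (breaker_claims t (maker_claims u E))"
proof (rule no_double_threat_reply[OF fin E nd, where B = "accessible L R E - {u}"])
  fix x assume x: "unblocked L (R - {u} - {t}) x"
  have "unblocked L R x"
  proof (rule ccontr)
    assume "\<not> unblocked L R x"
    then obtain a where a: "(a, x) \<in> L" "a \<in> R" using x blockedE[of x R] by (auto simp: unblocked_def)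
    then have "a = u \<or> a = t" using x by (auto simp: unblocked_def)
    then show False using a t x above_unique height by (auto simp: unblocked_def)
  qed
  then show "x \<in> accessible L R E - {u}"
    using x by (auto intro: accessible.unblocked simp: unblocked_def)
next
  fix z b s
  assume "z \<in> accessible L R E - {u}" "{b, z} \<in> E" "b \<noteq> z" "b \<in> R - {u} - {t}" "(b, s) \<in> L"
    "s \<in> R - {u} - {t}"
  then show "s \<in> accessible L R E - {u}" using accessible.top[of z L R E b s] by auto
qed (use u w in \<open>auto intro: accessible.unblocked\<close>)

text \<open>Nothing lies above \<open>u\<close>, so only \<open>v\<close> can free a vertex, and by
  the premise on \<open>v\<close> that vertex was accessible anyway.\<close>

lemma even_quiet_single:
  assumes fin: "finite R" and E: "E \<subseteq> Pow R" "\<And>S. S \<in> E \<Longrightarrow> card S \<le> 2"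
    and nd: "\<not> double_threat L R E" and u: "unblocked L R u"
    and w: "\<And>w. w \<in> accessible L R E \<Longrightarrow> {u, w} \<in> E \<Longrightarrow> u = w"
    and single: "\<And>t. (u, t) \<in> L \<Longrightarrow> t \<notin> R"
    and v: "unblocked L R v" "v \<noteq> u" "\<And>t. (v, t) \<in> L \<Longrightarrow> t \<in> R \<Longrightarrow> t \<in> accessible L R E"
  shows "\<not> double_threat L (R - {u} - {v}) (breaker_claims v (maker_claims u E))"
proof (rule no_double_threat_reply[OF fin E nd, where B = "accessible L R E - {u}"])
  fix x assume x: "unblocked L (R - {u} - {v}) x"
  then have xR: "x \<in> R" "x \<noteq> u" by (auto simp: unblocked_def)
  have "x \<in> accessible L R E"
  proof (cases "unblocked L R x")
    case False
    then obtain a where a: "(a, x) \<in> L" "a \<in> R" using xR blockedE[of x R] by auto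
    then have "a = u \<or> a = v" using x by (auto simp: unblocked_def)
    then show ?thesis using a single v(3) xR by auto
  qed (rule accessible.unblocked)
  then show "x \<in> accessible L R E - {u}" using xR by blast
next
  fix z b s
  assume "z \<in> accessible L R E - {u}" "{b, z} \<in> E" "b \<noteq> z" "b \<in> R - {u} - {v}" "(b, s) \<in> L"
    "s \<in> R - {u} - {v}"
  then show "s \<in> accessible L R E - {u}" using accessible.top[of z L R E b s] by auto
qed (use u w in \<open>auto intro: accessible.unblocked\<close>)

text \<open>The board splits into full chains, with bottoms and tops in bijection. Read backwards,
  an odd board has a free vertex with nothing above it.\<close>

lemma even_chains:
  assumes "finite R" and chain: "\<And>v. unblocked L R v \<Longrightarrow> \<exists>t\<in>R. (v, t) \<in> L"
  shows "even (card R)"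
proof -
  define top where "top v = (SOME t. t \<in> R \<and> (v, t) \<in> L)" for v
  have top: "top v \<in> R" "(v, top v) \<in> L" if "unblocked L R v" for v
    using chain[OF that] unfolding top_def by (metis (mono_tags, lifting) someI_ex)+
  let ?S = "{v. unblocked L R v}"
  have "inj_on top ?S"
    using top below_unique by (metis (mono_tags, lifting) inj_onI mem_Collect_eq)
  moreover have "top ` ?S = R - ?S"
  proof (intro set_eqI iffI)
    fix x assume "x \<in> top ` ?S"
    then show "x \<in> R - ?S" using top by (auto simp: unblocked_def)
  next
    fix x assume "x \<in> R - ?S"
    then obtain b where "(b, x) \<in> L" "unblocked L R b" using blockedE by blast
    then show "x \<in> top ` ?S" using top above_unique by (metis image_eqI mem_Collect_eq)
  qed
  ultimately have "card (R - ?S) = card ?S" by (metis card_image)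
  moreover have "?S \<subseteq> R" by (auto simp: unblocked_def)
  ultimately have "card R = 2 * card ?S"
    using assms(1) by (metis card_Diff_subset card_mono finite_subset le_add_diff_inverse mult_2)
  then show ?thesis by simp
qed

lemma even_breaker_wins:
  assumes "finite R" "even (card R)" "E \<subseteq> Pow R" "\<And>S. S \<in> E \<Longrightarrow> card S \<le> 2"
    "\<not> double_threat L R E"
  shows "breaker_wins L Maker R E"
  using assms
proof (induction "card R" arbitrary: R E rule: less_induct)
  case less
  show ?case
  proof (cases "R = {}")
    case True
    then show ?thesis using less.prems(5) by (auto simp: double_threat_def intro: breaker_wins.over)
  next
    case False
    then show ?thesis
    proof (rule breaker_wins.maker)
      fix u assume u: "unblocked L R u"
      have "\<exists>v. unblocked L (R - {u}) v \<and>
        \<not> double_threat L (R - {u} - {v}) (breaker_claims v (maker_claims u E))"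
      proof (cases "\<exists>w\<in>accessible L R E. {u, w} \<in> E \<and> u \<noteq> w")
        case True
        then show ?thesis using even_answer[OF less.prems(1,3,4,5) u] by blast
      next
        case no_partner: False
        show ?thesis
        proof (cases "\<exists>t\<in>R. (u, t) \<in> L")
          case True
          then obtain t where t: "(u, t) \<in> L" "t \<in> R" by blast
          then have "u \<noteq> t" using height by blast
          with t have "unblocked L (R - {u}) t" by (intro top_unblocked[of u]) auto
          then show ?thesis
            using even_quiet_chain[OF less.prems(1,3,4,5) u _ t] no_partner by blast
        next
          case single: False
          \<comment> \<open>Otherwise the board without \<open>u\<close> would split into chains of
            two and be even, although it has one vertex fewer than an even board.\<close>
          have "\<exists>v. unblocked L R v \<and> v \<noteq> u \<and> (\<forall>t\<in>R. (v, t) \<in> L \<longrightarrow> t \<in> accessible L R E)"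
          proof (rule ccontr)
            assume none: "\<not> ?thesis"
            have "\<exists>t\<in>R - {u}. (v, t) \<in> L" if v: "unblocked L (R - {u}) v" for v
            proof -
              have "unblocked L R v" using v single by (auto simp: unblocked_def)
              moreover have "v \<noteq> u" using v by (auto simp: unblocked_def)
              ultimately obtain t where "t \<in> R" "(v, t) \<in> L" using none by blast
              moreover have "t \<noteq> u" using u v \<open>(v, t) \<in> L\<close> by (auto simp: unblocked_def)
              ultimately show ?thesis by blast
            qed
            then have "even (card (R - {u}))"
              using less.prems(1) by (intro even_chains) auto
            moreover have "card R = Suc (card (R - {u}))"
              using u card.remove[OF less.prems(1), of u] by (simp add: unblocked_def)
            ultimately show False using less.prems(2) by simp
          qed
          then obtain v where v: "unblocked L R v" "v \<noteq> u"
            "\<And>t. (v, t) \<in> L \<Longrightarrow> t \<in> R \<Longrightarrow> t \<in> accessible L R E" by blast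
          then have "unblocked L (R - {u}) v" by (auto simp: unblocked_def)
          then show ?thesis
            using even_quiet_single[OF less.prems(1,3,4,5) u _ _ v] no_partner single by blast
        qed
      qed
      then obtain v where v: "unblocked L (R - {u}) v"
        and nd: "\<not> double_threat L (R - {u} - {v}) (breaker_claims v (maker_claims u E))" by blast
      have uv: "u \<in> R" "v \<in> R" "u \<noteq> v" using u v by (auto simp: unblocked_def)
      have card: "card R = Suc (Suc (card (R - {u} - {v})))"
        using uv less.prems(1) by (metis DiffI card.remove finite_Diff singletonD)
      show "breaker_wins L Breaker (R - {u}) (maker_claims u E)"
      proof (rule breaker_wins.breaker[OF v], rule less.hyps)
        show "card S \<le> 2" if "S \<in> breaker_claims v (maker_claims u E)" for S
        proof -
          obtain T where T: "T \<in> E" "S = T - {u}" using \<open>S \<in> _\<close> by (rule both_claimsE)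
          moreover have "finite T" using T less.prems(1,3) finite_subset by blast
          ultimately show ?thesis using less.prems(4)[OF T(1)] card_mono[of T S] by auto
        qed
        show "breaker_claims v (maker_claims u E) \<subseteq> Pow (R - {u} - {v})"
          using less.prems(3) by (auto simp: breaker_claims_def maker_claims_def)
      qed (use less.prems card nd in auto)
    qed
  qed
qed

section \<open>Pairing for Breaker on odd boards\<close>

text \<open>A pair may be a whole chain: if Maker takes its bottom, the top becomes available for
  the answer.\<close>

definition matched :: "'a set \<Rightarrow> 'a set set \<Rightarrow> bool" where
  "matched R E \<longleftrightarrow> E \<subseteq> Pow R \<and>
    (\<forall>S\<in>E. \<exists>x y. S = {x, y} \<and> x \<noteq> y \<and> unblocked L R x \<and> (unblocked L R y \<or> (x, y) \<in> L)) \<and>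
    (\<forall>S\<in>E. \<forall>T\<in>E. S \<noteq> T \<longrightarrow> S \<inter> T = {})"

lemma matchedE:
  assumes "matched R E" "S \<in> E"
  obtains x y where "S = {x, y}" "x \<noteq> y" "unblocked L R x" "unblocked L R y \<or> (x, y) \<in> L"
proof -
  have "\<forall>S\<in>E. \<exists>x y. S = {x, y} \<and> x \<noteq> y \<and> unblocked L R x \<and> (unblocked L R y \<or> (x, y) \<in> L)"
    using assms(1) unfolding matched_def by simp
  from bspec[OF this assms(2)] show ?thesis using that by (elim exE conjE) simp
qed

lemma matched_subset: "matched R E \<Longrightarrow> E \<subseteq> Pow R"
  by (simp add: matched_def)

lemma matched_disjoint: "matched R E \<Longrightarrow> S \<in> E \<Longrightarrow> T \<in> E \<Longrightarrow> S \<noteq> T \<Longrightarrow> S \<inter> T = {}"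
  by (simp add: matched_def)

lemma matched_mono:
  assumes "matched R E" "R' \<subseteq> R" "E' \<subseteq> E" "E' \<subseteq> Pow R'"
  shows "matched R' E'"
proof -
  have "\<exists>x y. S = {x, y} \<and> x \<noteq> y \<and> unblocked L R' x \<and> (unblocked L R' y \<or> (x, y) \<in> L)"
    if S: "S \<in> E'" for S
  proof -
    obtain x y where xy: "S = {x, y}" "x \<noteq> y" "unblocked L R x" "unblocked L R y \<or> (x, y) \<in> L"
      using assms(1) subsetD[OF assms(3) S] by (rule matchedE)
    have "x \<in> R'" "y \<in> R'" using xy(1) S assms(4) by auto
    then have "unblocked L R' x" "unblocked L R' y \<or> (x, y) \<in> L"
      using xy(3,4) unblocked_mono[OF _ assms(2)] by auto
    then show ?thesis using xy(1,2) by (intro exI conjI)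
  qed
  moreover have "S \<inter> T = {}" if "S \<in> E'" "T \<in> E'" "S \<noteq> T" for S T
    using matched_disjoint[OF assms(1)] that assms(3) by blast
  ultimately show ?thesis using assms(4) unfolding matched_def by simp
qed

text \<open>Breaker takes the other end of the pair that Maker has touched; disjointness protects
  the remaining pairs, so every surviving set is an old one, which is the condition
  \<open>sub\<close>. A move outside all pairs may be answered anywhere, since dropping sets
  preserves \<open>matched\<close>.\<close>

lemma matched_breaker_wins:
  assumes "finite R" "matched R E"
  shows "breaker_wins L Maker R E"
  using assms
proof (induction "card R" arbitrary: R E rule: less_induct)
  case less
  have ne: "{} \<notin> E" using matchedE[OF less.prems(2)] by blast
  show ?case
  proof (cases "R = {}")
    case True
    then show ?thesis using ne by (auto intro: breaker_wins.over)
  next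
    case False
    then show ?thesis
    proof (rule breaker_wins.maker)
      fix u assume u: "unblocked L R u"
      have reply: "breaker_wins L Breaker (R - {u}) (maker_claims u E)"
        if v: "unblocked L (R - {u}) v" and sub: "breaker_claims v (maker_claims u E) \<subseteq> E" for v
      proof (rule breaker_wins.breaker[OF v], rule less.hyps)
        show "card (R - {u} - {v}) < card R"
          using less.prems(1) u by (intro psubset_card_mono) (auto simp: unblocked_def)
        show "matched (R - {u} - {v}) (breaker_claims v (maker_claims u E))"
        proof (rule matched_mono[OF less.prems(2) _ sub])
          show "breaker_claims v (maker_claims u E) \<subseteq> Pow (R - {u} - {v})"
            using matched_subset[OF less.prems(2)] by (auto simp: breaker_claims_def maker_claims_def)
        qed auto
      qed (use less.prems in auto)
      show "breaker_wins L Breaker (R - {u}) (maker_claims u E)"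
      proof (cases "\<exists>S\<in>E. u \<in> S")
        case True
        then obtain S where S: "S \<in> E" "u \<in> S" by blast
        obtain x y where xy: "S = {x, y}" "x \<noteq> y" "unblocked L R x" "unblocked L R y \<or> (x, y) \<in> L"
          by (rule matchedE[OF less.prems(2) S(1)])
        have "S \<subseteq> R" using S matched_subset[OF less.prems(2)] by blast
        obtain w where w: "S = {u, w}" "u \<noteq> w" "unblocked L (R - {u}) w"
        proof (cases "x = u")
          case True
          have "y \<in> R - {u}" using xy \<open>S \<subseteq> R\<close> True by auto
          then have "unblocked L (R - {u}) y"
            using xy(4) True top_unblocked[of u y "R - {u}"] by (auto simp: unblocked_def)
          then show ?thesis using that xy True by blast
        next
          case False
          then have "y = u" using S xy by auto
          moreover have "unblocked L (R - {u}) x" using xy False by (auto simp: unblocked_def)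
          ultimately show ?thesis using that[of x] xy False by (auto simp: insert_commute)
        qed
        have "T - {u} \<in> E" if "T \<in> E" "w \<notin> T - {u}" for T
        proof -
          have "T \<noteq> S" using that w by auto
          then have "T \<inter> S = {}" using matched_disjoint[OF less.prems(2)] that S by blast
          then have "u \<notin> T" using S by blast
          then show ?thesis using that by simp
        qed
        then show ?thesis
          using w by (intro reply) (auto simp: breaker_claims_def maker_claims_def)
      next
        case untouched: False
        then have "S - {u} = S" if "S \<in> E" for S
          using that by blast
        then have same: "maker_claims u E = E"
          by (simp add: maker_claims_def)
        show ?thesis
        proof (cases "R - {u} = {}")
          case True
          show ?thesis unfolding True same using ne by (rule breaker_wins.over)
        next
          case False
          then obtain x where "x \<in> R - {u}" by blast
          then obtain v where "unblocked L (R - {u}) v" using blockedE[of x "R - {u}"] by metis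
          then show ?thesis by (rule reply) (auto simp: same breaker_claims_def)
        qed
      qed
    qed
  qed
qed

text \<open>Failure of the criterion leaves only pairs, and a blocked top occurs only together with
  its own bottom. This is exactly what pairing needs, once the pairs are known to be
  disjoint.\<close>

lemma odd_breaker_wins:
  assumes "finite R" "odd (card R)" "L \<subseteq> R \<times> R" "E \<subseteq> Pow R" "\<And>S. S \<in> E \<Longrightarrow> card S \<le> 2"
    "\<not> maker_criterion L R E"
  shows "breaker_wins L Maker R E"
proof (rule matched_breaker_wins[OF assms(1)])
  have nd: "\<not> double_threat L R E" and no_unit: "\<And>v. {v} \<notin> E"
    and own_top: "\<And>p b t. (b, t) \<in> L \<Longrightarrow> {p, t} \<in> E \<Longrightarrow> p \<noteq> t \<Longrightarrow> p = b"
    using assms(2,6) by (auto simp: maker_criterion_def)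
  have pair: "\<exists>x y. S = {x, y} \<and> x \<noteq> y" if "S \<in> E" for S
  proof -
    have "S \<noteq> {}" using nd that by (auto simp: double_threat_def)
    moreover have "finite S" using that assms(1,4) finite_subset by blast
    ultimately have "card S = 1 \<or> card S = 2" using assms(5)[OF that] card_gt_0_iff[of S] by linarith
    then show ?thesis using that no_unit by (auto simp: card_1_singleton_iff card_2_iff)
  qed
  have shape: "unblocked L R x \<and> (unblocked L R y \<or> (x, y) \<in> L)"
    if "{x, y} \<in> E" "x \<noteq> y" "unblocked L R x" for x y
  proof (cases "unblocked L R y")
    case False
    moreover have "y \<in> R" using that assms(4) by auto
    ultimately obtain b where "(b, y) \<in> L" by (metis blockedE)
    then show ?thesis using own_top[of b y x] that by auto
  qed (use that in auto)
  have one: "unblocked L R x \<or> unblocked L R y" if "{x, y} \<in> E" "x \<noteq> y" for x y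
  proof (rule ccontr)
    assume none: "\<not> ?thesis"
    moreover have "y \<in> R" using that assms(4) by auto
    ultimately obtain b where "(b, y) \<in> L" "unblocked L R b" using blockedE[of y R] by metis
    then show False using own_top[of b y x] that none by auto
  qed
  have "S \<inter> T = {}" if S: "S \<in> E" "T \<in> E" "S \<noteq> T" for S T
  proof (rule ccontr)
    assume "S \<inter> T \<noteq> {}"
    then obtain s where s: "s \<in> S" "s \<in> T" by blast
    obtain a where a: "S = {s, a}" "s \<noteq> a" using pair[OF S(1)] s by (metis doubleton_eq_iff insertE singletonD)
    obtain c where c: "T = {s, c}" "s \<noteq> c" using pair[OF S(2)] s by (metis doubleton_eq_iff insertE singletonD)
    have ac: "a \<noteq> c" "{s, a} \<in> E" "{s, c} \<in> E" using a c S by auto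
    show False
    proof (cases "unblocked L R s")
      case True
      have sA: "s \<in> accessible L R E" using True by (rule accessible.unblocked)
      have "a \<in> R" "c \<in> R" using ac assms(4) by auto
      have a': "unblocked L R a \<or> (s, a) \<in> L" and c': "unblocked L R c \<or> (s, c) \<in> L"
        using shape True a c ac by blast+
      \<comment> \<open>If one of \<open>a\<close>, \<open>c\<close> is the top above
        \<open>s\<close>, the other is free, and its pair with \<open>s\<close> makes that top
        accessible.\<close>
      have "a \<in> accessible L R E \<and> c \<in> accessible L R E"
        using a' c' accessible_neighbour[OF sA _ ac(2) a(2), of c] accessible_neighbour[OF sA _ ac(3) c(2), of a]
          above_unique[of s a c] ac(1) \<open>a \<in> R\<close> \<open>c \<in> R\<close> accessible.unblocked[of L R _ E] by blast
      then show False using accessible_unique[OF nd sA _ _ ac(2,3)] a c ac by auto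
    next
      case False
      moreover have "s \<in> R" using ac assms(4) by auto
      ultimately obtain b where b: "(b, s) \<in> L" by (metis blockedE)
      then have "a = b" "c = b" using own_top[of b s] ac a c by (auto simp: insert_commute)
      then show False using ac by simp
    qed
  qed
  moreover have "\<exists>x y. S = {x, y} \<and> x \<noteq> y \<and> unblocked L R x \<and> (unblocked L R y \<or> (x, y) \<in> L)"
    if S: "S \<in> E" for S
  proof -
    obtain x y where xy: "S = {x, y}" "x \<noteq> y" using pair S by blast
    then show ?thesis
      using one[of x y] shape[of x y] shape[of y x] S by (metis insert_commute)
  qed
  ultimately show "matched R E" using assms(4) unfolding matched_def by simp
qed

theorem criterion_decides:
  assumes "finite R" "L \<subseteq> R \<times> R" "E \<subseteq> Pow R" "\<And>S. S \<in> E \<Longrightarrow> card S \<le> 2"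
  shows "if maker_criterion L R E then maker_wins L Maker R E else breaker_wins L Maker R E"
  using assms maker_criterion_wins odd_breaker_wins even_breaker_wins
  by (cases "even (card R)") (auto simp: maker_criterion_def)

end

section \<open>Reasoning about word RAM programs\<close>

text \<open>The time is bounded only from above, because the branches of a conditional differ in
  cost.\<close>

definition runs :: "nat \<Rightarrow> com \<Rightarrow> state \<Rightarrow> nat \<Rightarrow> (state \<Rightarrow> bool) \<Rightarrow> bool" where
  "runs w c s t Q \<longleftrightarrow> (\<exists>t' s'. exec w c s t' s' \<and> t' \<le> t \<and> Q s')"

lemma runs_mono:
  "runs w c s t Q \<Longrightarrow> t \<le> t' \<Longrightarrow> (\<And>s. Q s \<Longrightarrow> Q' s) \<Longrightarrow> runs w c s t' Q'"
  unfolding runs_def by (meson le_trans)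

lemma runs_Seq:
  assumes "runs w c s t Q" "\<And>s. Q s \<Longrightarrow> runs w d s u R"
  shows "runs w (Seq c d) s (t + u) R"
proof -
  obtain t' s' where c: "exec w c s t' s'" "t' \<le> t" "Q s'" using assms(1) by (auto simp: runs_def)
  obtain u' s'' where d: "exec w d s' u' s''" "u' \<le> u" "R s''"
    using assms(2)[OF c(3)] by (auto simp: runs_def)
  show ?thesis
    unfolding runs_def using exec.Seq[OF c(1) d(1)] c(2) d(2,3) add_mono by blast
qed

text \<open>Code without loops is handled by symbolic execution, with the overflow conditions
  included. \<open>While\<close> yields \<open>False\<close>, as loops have their own rule.\<close>

primrec loop_free_wp :: "nat \<Rightarrow> com \<Rightarrow> (state \<Rightarrow> bool) \<Rightarrow> state \<Rightarrow> bool" where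
  "loop_free_wp w Skip Q s \<longleftrightarrow> Q s"
| "loop_free_wp w (Assign x e) Q s \<longleftrightarrow> fits w e s \<and> Q (s\<lparr>vars := (vars s)(x := val e s)\<rparr>)"
| "loop_free_wp w (Store a i e) Q s \<longleftrightarrow> fits w i s \<and> fits w e s \<and>
    Q (s\<lparr>arrs := (arrs s)(a := (arrs s a)(val i s := val e s))\<rparr>)"
| "loop_free_wp w (Seq c d) Q s \<longleftrightarrow> loop_free_wp w c (loop_free_wp w d Q) s"
| "loop_free_wp w (Cond b c d) Q s \<longleftrightarrow> bfits w b s \<and>
    (bval b s \<longrightarrow> loop_free_wp w c Q s) \<and> (\<not> bval b s \<longrightarrow> loop_free_wp w d Q s)"
| "loop_free_wp w (While b c) Q s \<longleftrightarrow> False"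

primrec loop_free_time :: "com \<Rightarrow> nat" where
  "loop_free_time Skip = 1"
| "loop_free_time (Assign x e) = 1 + cost e"
| "loop_free_time (Store a i e) = 1 + cost i + cost e"
| "loop_free_time (Seq c d) = loop_free_time c + loop_free_time d"
| "loop_free_time (Cond b c d) = 1 + bcost b + max (loop_free_time c) (loop_free_time d)"
| "loop_free_time (While b c) = 0"

lemma runs_loop_free:
  "loop_free_wp w c Q s \<Longrightarrow> runs w c s (loop_free_time c) Q"
proof (induction c arbitrary: Q s)
  case (Seq c d)
  then show ?case
    unfolding loop_free_time.simps loop_free_wp.simps by (blast intro: runs_Seq)
next
  case (Cond b c d)
  show ?case
  proof (cases "bval b s")
    case True
    then have "runs w c s (loop_free_time c) Q" using Cond by simp
    then obtain t s' where "exec w c s t s'" "t \<le> loop_free_time c" "Q s'" by (auto simp: runs_def)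
    moreover from this have "exec w (Cond b c d) s (1 + bcost b + t) s'"
      using Cond.prems True by (intro exec.CondTrue) auto
    ultimately show ?thesis unfolding runs_def by (intro exI conjI) auto
  next
    case False
    then have "runs w d s (loop_free_time d) Q" using Cond by simp
    then obtain t s' where "exec w d s t s'" "t \<le> loop_free_time d" "Q s'" by (auto simp: runs_def)
    moreover from this have "exec w (Cond b c d) s (1 + bcost b + t) s'"
      using Cond.prems False by (intro exec.CondFalse) auto
    ultimately show ?thesis unfolding runs_def by (intro exI conjI) auto
  qed
next
  case Skip
  have "exec w Skip s 1 s" by (rule exec.Skip)
  then show ?case using Skip unfolding runs_def by auto
next
  case (Assign x e)
  then show ?case unfolding runs_def
    by (intro exI[of _ "1 + cost e"] exI[of _ "s\<lparr>vars := (vars s)(x := val e s)\<rparr>"])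
      (auto intro: exec.Assign[simplified])
next
  case (Store a i e)
  then show ?case unfolding runs_def
    by (intro exI[of _ "1 + cost i + cost e"]
        exI[of _ "s\<lparr>arrs := (arrs s)(a := (arrs s a)(val i s := val e s))\<rparr>"])
      (auto intro: exec.Store[simplified])
qed simp

definition For :: "string \<Rightarrow> string \<Rightarrow> com \<Rightarrow> com" where
  "For x N c = Seq (Assign x (Const 0))
    (While (Less (Var x) (Var N)) (Seq c (Assign x (Plus (Var x) (Const 1)))))"

definition set_var :: "string \<Rightarrow> nat \<Rightarrow> state \<Rightarrow> state" where
  "set_var x k s = s\<lparr>vars := (vars s)(x := k)\<rparr>"

lemma vars_set_var [simp]: "vars (set_var x k s) y = (if y = x then k else vars s y)"
  by (simp add: set_var_def)

lemma arrs_set_var [simp]: "arrs (set_var x k s) = arrs s"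
  by (simp add: set_var_def)

text \<open>Test and increment cost 4 each, hence \<open>t + 8\<close> per round; initialisation
  costs 2 and the last test 4, hence 6. The invariant speaks of the moment of the test, so the body
  has to establish it for the state with the counter already raised. \<open>m < 2 ^ w\<close> keeps
  the last increment from overflowing.\<close>

lemma runs_For:
  assumes m: "m < 2 ^ w" and start: "I 0 (set_var x 0 s)"
    and bound: "\<And>k s. I k s \<Longrightarrow> vars s N = m"
    and body: "\<And>k s. k < m \<Longrightarrow> I k s \<Longrightarrow> vars s x = k \<Longrightarrow>
      runs w c s t (\<lambda>s'. vars s' x = k \<and> I (Suc k) (set_var x (Suc k) s'))"
  shows "runs w (For x N c) s (m * (t + 8) + 6) (I m)"
proof -
  let ?b = "Less (Var x) (Var N)" and ?c = "Seq c (Assign x (Plus (Var x) (Const 1)))"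
  have loop: "runs w (While ?b ?c) s (d * (t + 8) + 4) (I m)"
    if "I k s" "vars s x = k" "k + d = m" for d k s
    using that
  proof (induction d arbitrary: k s)
    case 0
    then have "bfits w ?b s" "\<not> bval ?b s" using bound[of k s] m by auto
    then have "exec w (While ?b ?c) s (1 + bcost ?b) s" by (rule exec.WhileFalse)
    moreover have "1 + bcost ?b \<le> 0 * (t + 8) + 4" "I m s" using 0 by auto
    ultimately show ?case unfolding runs_def by blast
  next
    case (Suc d)
    then have k: "k < m" by simp
    then have b: "bfits w ?b s" "bval ?b s" using Suc.prems bound[of k s] m by auto
    obtain t1 s1 where s1: "exec w c s t1 s1" "t1 \<le> t" "vars s1 x = k" "I (Suc k) (set_var x (Suc k) s1)"
      using body[OF k Suc.prems(1,2)] by (auto simp: runs_def)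
    have "exec w (Assign x (Plus (Var x) (Const 1))) s1 4 (set_var x (Suc k) s1)"
      using exec.Assign[of w "Plus (Var x) (Const 1)" s1 x] s1(3) k m by (simp add: set_var_def eval_nat_numeral)
    with s1(1) have c: "exec w ?c s (t1 + 4) (set_var x (Suc k) s1)" by (rule exec.Seq)
    obtain t2 s2 where s2: "exec w (While ?b ?c) (set_var x (Suc k) s1) t2 s2"
      "t2 \<le> d * (t + 8) + 4" "I m s2"
      using Suc.IH[OF s1(4)] Suc.prems(3) by (auto simp: runs_def)
    have "exec w (While ?b ?c) s (1 + bcost ?b + (t1 + 4) + t2) s2"
      by (rule exec.WhileTrue[OF b c s2(1)])
    moreover have "1 + bcost ?b + (t1 + 4) + t2 \<le> Suc d * (t + 8) + 4"
      using s1(2) s2(2) by simp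
    ultimately show ?case unfolding runs_def using s2(3) by blast
  qed
  have "exec w (Assign x (Const 0)) s 2 (set_var x 0 s)"
    using exec.Assign[of w "Const 0" s x] by (simp add: set_var_def numeral_2_eq_2)
  then have "runs w (Assign x (Const 0)) s 2 (\<lambda>s'. s' = set_var x 0 s)"
    unfolding runs_def by blast
  then have "runs w (For x N c) s (2 + (m * (t + 8) + 4)) (I m)"
    unfolding For_def by (rule runs_Seq) (use loop[of 0 "set_var x 0 s" m] start in auto)
  then show ?thesis by (simp add: add.commute add.left_commute)
qed

lemma runs_loop_free_For:
  assumes "m < 2 ^ w" "I 0 (set_var x 0 s)" "\<And>k s. I k s \<Longrightarrow> vars s N = m"
    and "\<And>k s. k < m \<Longrightarrow> I k s \<Longrightarrow> vars s x = k \<Longrightarrow>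
      loop_free_wp w c (\<lambda>s'. vars s' x = k \<and> I (Suc k) (set_var x (Suc k) s')) s"
  shows "runs w (For x N c) s (m * (loop_free_time c + 8) + 6) (I m)"
  using assms by (intro runs_For runs_loop_free)

text \<open>A search can only raise the flag \<open>result\<close>, so nested and consecutive
  searches accumulate a disjunction. \<open>\<phi>\<close> is a plain truth value because
  \<open>F\<close> determines everything that the search reads.\<close>

definition searches :: "nat \<Rightarrow> com \<Rightarrow> nat \<Rightarrow> (state \<Rightarrow> bool) \<Rightarrow> bool \<Rightarrow> bool" where
  "searches w c t F \<phi> \<longleftrightarrow> (\<forall>s b. F s \<and> result s = of_bool b \<longrightarrow>
    runs w c s t (\<lambda>s'. F s' \<and> result s' = of_bool (b \<or> \<phi>)))"

lemma searches_For:
  assumes "m < 2 ^ w" "x \<noteq> ''result''"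
    and "\<And>k. k < m \<Longrightarrow> searches w c t (\<lambda>s. F s \<and> vars s x = k) (\<phi> k)"
    and "\<And>s k. F s \<Longrightarrow> F (set_var x k s)" "\<And>s. F s \<Longrightarrow> vars s N = m"
  shows "searches w (For x N c) (m * (t + 8) + 6) F (\<exists>k<m. \<phi> k)"
  unfolding searches_def
proof (intro allI impI, elim conjE)
  fix s b assume s: "F s" "result s = of_bool b"
  show "runs w (For x N c) s (m * (t + 8) + 6) (\<lambda>s'. F s' \<and> result s' = of_bool (b \<or> (\<exists>k<m. \<phi> k)))"
  proof (rule runs_For[where I = "\<lambda>k s'. F s' \<and> result s' = of_bool (b \<or> (\<exists>i<k. \<phi> i))"])
    fix k s' assume k: "k < m" "F s' \<and> result s' = of_bool (b \<or> (\<exists>i<k. \<phi> i))" "vars s' x = k"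
    then have "runs w c s' t (\<lambda>s''. (F s'' \<and> vars s'' x = k) \<and> result s'' = of_bool ((b \<or> (\<exists>i<k. \<phi> i)) \<or> \<phi> k))"
      using assms(3)[OF k(1)] unfolding searches_def by blast
    then show "runs w c s' t (\<lambda>s''. vars s'' x = k \<and> F (set_var x (Suc k) s'') \<and>
        result (set_var x (Suc k) s'') = of_bool (b \<or> (\<exists>i<Suc k. \<phi> i)))"
      by (rule runs_mono) (use assms(2,4) in \<open>auto simp: result_def less_Suc_eq\<close>)
  qed (use assms s in \<open>auto simp: result_def\<close>)
qed

lemma searches_Cond:
  assumes "\<And>s. F s \<Longrightarrow> bfits w g s \<and> (bval g s \<longleftrightarrow> \<phi>)" "\<And>s. F s \<Longrightarrow> F (set_var ''result'' 1 s)" "1 \<le> w"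
  shows "searches w (Cond g (Assign ''result'' (Const 1)) Skip) (3 + bcost g) F \<phi>"
  unfolding searches_def
proof (intro allI impI, elim conjE)
  fix s b assume s: "F s" "result s = of_bool b"
  have "(1::nat) < 2 ^ w" using assms(3) by (metis one_less_numeral_iff one_less_power semiring_norm(76) less_eq_Suc_le One_nat_def)
  then have "loop_free_wp w (Cond g (Assign ''result'' (Const 1)) Skip)
      (\<lambda>s'. F s' \<and> result s' = of_bool (b \<or> \<phi>)) s"
    using assms(1)[OF s(1)] assms(2)[OF s(1)] s by (auto simp: result_def set_var_def)
  then show "runs w (Cond g (Assign ''result'' (Const 1)) Skip) s (3 + bcost g)
      (\<lambda>s'. F s' \<and> result s' = of_bool (b \<or> \<phi>))"
    by (rule runs_mono[OF runs_loop_free]) auto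
qed

section \<open>The decision program\<close>

definition read_header :: com where
  "read_header =
    Seq (Assign ''n'' (Arr ''input'' (Const 0)))
    (Seq (Assign ''r'' (Arr ''input'' (Const 1)))
    (Seq (Assign ''m'' (Arr ''input'' (Const 2)))
         (Assign ''p'' (Const 3))))"

text \<open>Cell \<open>t\<close> of \<open>below\<close> holds \<open>b + 1\<close> if \<open>b\<close> is below \<open>t\<close>, and 0 if \<open>t\<close> has no vertex below it. The
  variable \<open>q\<close> holds the parity of the number of vertices.\<close>

definition read_relation :: com where
  "read_relation =
    Seq (Store ''below'' (Arr ''input'' (Plus (Var ''p'') (Const 1))) (Plus (Arr ''input'' (Var ''p'')) (Const 1)))
        (Assign ''p'' (Plus (Var ''p'') (Const 2)))"

definition cell :: "exp \<Rightarrow> exp \<Rightarrow> exp" where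
  "cell i j = Plus (Times i (Var ''n'')) j"

definition read_set :: com where
  "read_set =
    Seq (Assign ''l'' (Arr ''input'' (Var ''p'')))
    (Seq (Cond (Equal (Var ''l'') (Const 0))
           (Assign ''result'' (Const 1))
           (Seq (Assign ''u'' (Arr ''input'' (Plus (Var ''p'') (Const 1))))
             (Cond (Equal (Var ''l'') (Const 1))
               (Store ''unit'' (Var ''u'') (Const 1))
               (Seq (Assign ''v'' (Arr ''input'' (Plus (Var ''p'') (Const 2))))
               (Seq (Store ''adj'' (cell (Var ''u'') (Var ''v'')) (Const 1))
                    (Store ''adj'' (cell (Var ''v'') (Var ''u'')) (Const 1)))))))
         (Assign ''p'' (Plus (Var ''p'') (Plus (Var ''l'') (Const 1)))))"

text \<open>The machine has no remainder operation, so the parity is toggled by \<open>1 - q\<close>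
  once per vertex.\<close>

definition init_vertex :: com where
  "init_vertex =
    Seq (Assign ''q'' (Minus (Const 1) (Var ''q'')))
        (Cond (Equal (Arr ''below'' (Var ''i'')) (Const 0)) (Store ''acc'' (Var ''i'') (Const 1)) Skip)"

text \<open>All conjuncts must fit the word length, so the matrix is read even where
  \<open>below\<close> is 0. Truncated subtraction then gives row 0, which still lies inside the
  matrix.\<close>

definition extend :: com where
  "extend =
    Cond (BAnd (BNot (Equal (Arr ''below'' (Var ''i'')) (Const 0)))
      (BAnd (Equal (Arr ''acc'' (Var ''j'')) (Const 1))
        (Equal (Arr ''adj'' (cell (Minus (Arr ''below'' (Var ''i'')) (Const 1)) (Var ''j''))) (Const 1))))
      (Store ''acc'' (Var ''i'') (Const 1)) Skip"

definition report :: "bexp \<Rightarrow> com" where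
  "report g = Cond g (Assign ''result'' (Const 1)) Skip"

text \<open>A sum of two 0/1 values is positive iff one of them is 1: the disjunction of
  accessibility and odd parity.\<close>

definition unit_guard :: bexp where
  "unit_guard = BAnd (Equal (Arr ''unit'' (Var ''i'')) (Const 1))
    (Less (Const 0) (Plus (Arr ''acc'' (Var ''i'')) (Var ''q'')))"

definition fork_guard :: bexp where
  "fork_guard =
    BAnd (Equal (Arr ''acc'' (Var ''i'')) (Const 1))
    (BAnd (Equal (Arr ''acc'' (Var ''j'')) (Const 1))
    (BAnd (Equal (Arr ''acc'' (Var ''k'')) (Const 1))
    (BAnd (Equal (Arr ''adj'' (cell (Var ''i'') (Var ''j''))) (Const 1))
    (BAnd (Equal (Arr ''adj'' (cell (Var ''i'') (Var ''k''))) (Const 1))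
          (BNot (Equal (Var ''j'') (Var ''k'')))))))"

text \<open>As \<open>below\<close> is shifted by 1, comparison with \<open>i + 1\<close> detects
  that \<open>i\<close> is the bottom of \<open>j\<close>, that is, that the pair is the chain
  itself.\<close>

definition top_guard :: bexp where
  "top_guard =
    BAnd (Equal (Var ''q'') (Const 1))
    (BAnd (Equal (Arr ''adj'' (cell (Var ''i'') (Var ''j''))) (Const 1))
    (BAnd (BNot (Equal (Arr ''below'' (Var ''j'')) (Const 0)))
          (BNot (Equal (Arr ''below'' (Var ''j'')) (Plus (Var ''i'') (Const 1))))))"

definition decide :: com where
  "decide =
    Seq read_header
    (Seq (For ''k'' ''r'' read_relation)
    (Seq (For ''k'' ''m'' read_set)
    (Seq (For ''i'' ''n'' init_vertex)
    (Seq (For ''k'' ''n'' (For ''i'' ''n'' (For ''j'' ''n'' extend)))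
    (Seq (For ''i'' ''n'' (report unit_guard))
    (Seq (For ''i'' ''n'' (For ''j'' ''n'' (For ''k'' ''n'' (report fork_guard))))
         (For ''i'' ''n'' (For ''j'' ''n'' (report top_guard)))))))))"

section \<open>Layout of the input and of the matrix\<close>

lemma nth_concat_map:
  assumes "k < length ys" "i < length (f (ys ! k))"
  shows "concat (map f ys) ! (length (concat (map f (take k ys))) + i) = f (ys ! k) ! i"
    "length (concat (map f (take k ys))) + i < length (concat (map f ys))"
proof -
  have "concat (map f ys) = concat (map f (take k ys)) @ f (ys ! k) @ concat (map f (drop (Suc k) ys))"
    using id_take_nth_drop[OF assms(1)] by (metis concat.simps(2) concat_append list.simps(9) map_append)
  then show "concat (map f ys) ! (length (concat (map f (take k ys))) + i) = f (ys ! k) ! i"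
    "length (concat (map f (take k ys))) + i < length (concat (map f ys))"
    using assms(2) by (simp_all add: nth_append del: concat_append map_append)
qed

lemma cell_inj:
  assumes "(b::nat) < n" "b' < n"
  shows "a * n + b = a' * n + b' \<longleftrightarrow> a = a' \<and> b = b'"
proof
  assume eq: "a * n + b = a' * n + b'"
  have "(a * n + b) mod n = b" "(a' * n + b') mod n = b'" using assms by auto
  then have "b = b'" using eq by simp
  then show "a = a' \<and> b = b'" using eq assms by auto
qed simp

lemma cell_bound:
  assumes "(a::nat) < n" "b < n"
  shows "a * n + b < n * n"
proof -
  have "a * n + b < Suc a * n" using assms(2) by simp
  also have "\<dots> \<le> n * n" using assms(1) by (intro mult_le_mono1) simp
  finally show ?thesis .
qed

text \<open>The game as the program sees it, on the numbers below \<open>n\<close>; the given board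
  is linked to it only at the end, by its numbering.\<close>

locale numbered_game =
  fixes n :: nat and rs :: "(nat \<times> nat) list" and es :: "nat list list"
  assumes rs: "set rs \<subseteq> {..<n} \<times> {..<n}"
    and below_unique: "(a, t) \<in> set rs \<Longrightarrow> (b, t) \<in> set rs \<Longrightarrow> a = b"
    and es: "e \<in> set es \<Longrightarrow> distinct e \<and> set e \<subseteq> {..<n} \<and> length e \<le> 2"
begin

definition input :: "nat list" where
  "input = [n, length rs, length es] @ concat (map (\<lambda>(a, b). [a, b]) rs)
    @ concat (map (\<lambda>e. length e # e) es)"

definition E :: "nat set set" where "E = set ` set es"

definition offset :: "nat \<Rightarrow> nat" where
  "offset k = 3 + 2 * length rs + length (concat (map (\<lambda>e. length e # e) (take k es)))"

lemma length_rs: "length (concat (map (\<lambda>(a, b). [a, b]) xs)) = 2 * length xs"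
  by (induction xs) auto

lemma length_es: "length xs \<le> length (concat (map (\<lambda>e. length e # e) xs))"
  by (induction xs) auto

lemma input_header: "input ! 0 = n" "input ! Suc 0 = length rs" "input ! 2 = length es" "3 \<le> length input"
  by (auto simp: input_def eval_nat_numeral)

lemma input_relation:
  assumes "k < length rs"
  shows "input ! (3 + 2 * k) = fst (rs ! k)" "input ! (4 + 2 * k) = snd (rs ! k)"
    "4 + 2 * k < length input"
proof -
  let ?f = "\<lambda>(a::nat, b). [a, b]"
  have len: "length (?f (rs ! k)) = 2" by (simp split: prod.split)
  have off: "length (concat (map ?f (take k rs))) = 2 * k" using assms length_rs[of "take k rs"] by simp
  have a: "concat (map ?f rs) ! (2 * k + i) = ?f (rs ! k) ! i" "2 * k + i < length (concat (map ?f rs))"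
    if "i < 2" for i
    using nth_concat_map[of k rs i ?f] assms that len off by auto
  have b: "input ! (3 + j) = concat (map ?f rs) ! j" "3 + j < length input"
    if "j < length (concat (map ?f rs))" for j
    using that by (auto simp: input_def nth_append eval_nat_numeral)
  show "input ! (3 + 2 * k) = fst (rs ! k)"
    using a[of 0] b[of "2 * k"] by (simp split: prod.split)
  show "input ! (4 + 2 * k) = snd (rs ! k)" "4 + 2 * k < length input"
    using a[of 1] b[of "2 * k + 1"] by (simp_all split: prod.split)
qed

lemma input_set:
  assumes "k < length es" "i \<le> length (es ! k)"
  shows "input ! (offset k + i) = (length (es ! k) # es ! k) ! i" "offset k + i < length input"
proof -
  let ?f = "\<lambda>e::nat list. length e # e"
  have "input ! (3 + 2 * length rs + j) = concat (map ?f es) ! j" "3 + 2 * length rs + j < length input"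
    if "j < length (concat (map ?f es))" for j
    using that length_rs[of rs] by (auto simp: input_def nth_append)
  from this[of "length (concat (map ?f (take k es))) + i"]
  show "input ! (offset k + i) = (length (es ! k) # es ! k) ! i" "offset k + i < length input"
    using nth_concat_map[of k es i ?f] assms by (simp_all add: offset_def add.assoc)
qed

lemma offset_Suc: "k < length es \<Longrightarrow> offset (Suc k) = offset k + (length (es ! k) + 1)"
  by (simp add: offset_def take_Suc_conv_app_nth)

lemma offset_0: "offset 0 = 3 + 2 * length rs"
  by (simp add: offset_def)

end

section \<open>Reading the input\<close>

text \<open>The two bounds serve the two sources of large values, matrix cells and input positions;
  the slack of 10 absorbs the constants added to them.\<close>

locale word_ram_game = numbered_game +
  fixes w :: nat
  assumes word: "n * n + n + 10 < 2 ^ w" "length input + 10 < 2 ^ w"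
begin

definition loaded :: "state \<Rightarrow> bool" where
  "loaded s \<longleftrightarrow> vars s ''n'' = n \<and> vars s ''r'' = length rs \<and> vars s ''m'' = length es \<and>
    (\<forall>i<length input. arrs s ''input'' i = input ! i)"

text \<open>Memory starts at zero, so this predicate and \<open>sets_read\<close> hold for
  \<open>k = 0\<close> without any clearing of arrays.\<close>

definition order_read :: "nat \<Rightarrow> state \<Rightarrow> bool" where
  "order_read k s \<longleftrightarrow> (\<forall>b t. arrs s ''below'' t = Suc b \<longleftrightarrow> (b, t) \<in> set (take k rs))"

definition sets_read :: "nat \<Rightarrow> state \<Rightarrow> bool" where
  "sets_read k s \<longleftrightarrow>
    (\<forall>a. arrs s ''unit'' a = of_bool ({a} \<in> set ` set (take k es))) \<and>
    (\<forall>a<n. \<forall>b<n. arrs s ''adj'' (a * n + b) = of_bool (a \<noteq> b \<and> {a, b} \<in> set ` set (take k es)))"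

lemma header_small: "n < 2 ^ w" "length rs < 2 ^ w" "length es < 2 ^ w" "(13::nat) < 2 ^ w" "10 + n < 2 ^ w"
proof -
  have "length rs \<le> length input" "length es \<le> length input"
    using length_rs[of rs] length_es[of es] by (auto simp: input_def)
  then show "n < 2 ^ w" "length rs < 2 ^ w" "length es < 2 ^ w" "(13::nat) < 2 ^ w" "10 + n < 2 ^ w"
    using word input_header(4) by linarith+
qed

lemma runs_read_header:
  "runs w read_header (initial_state input) 11 (\<lambda>s. loaded s \<and> vars s ''p'' = 3 \<and> order_read 0 s \<and>
    sets_read 0 s \<and> result s = 0 \<and> vars s ''q'' = 0 \<and> arrs s ''acc'' = (\<lambda>_. 0))"
proof -
  have wp: "loop_free_wp w read_header (\<lambda>s. loaded s \<and> vars s ''p'' = 3 \<and> order_read 0 s \<and>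
    sets_read 0 s \<and> result s = 0 \<and> vars s ''q'' = 0 \<and> arrs s ''acc'' = (\<lambda>_. 0)) (initial_state input)"
    using input_header header_small
    by (auto simp: read_header_def initial_state_def loaded_def order_read_def sets_read_def result_def)
  show ?thesis
    by (rule runs_mono[OF runs_loop_free[OF wp]]) (simp_all add: read_header_def)
qed

lemma read_order:
  assumes "loaded s" "vars s ''p'' = 3" "order_read 0 s"
    "sets_read 0 s \<and> result s = 0 \<and> vars s ''q'' = 0 \<and> arrs s ''acc'' = (\<lambda>_. 0)"
  shows "runs w (For ''k'' ''r'' read_relation) s (length rs * 21 + 6) (\<lambda>s. loaded s \<and>
    vars s ''p'' = offset 0 \<and> order_read (length rs) s \<and>
    sets_read 0 s \<and> result s = 0 \<and> vars s ''q'' = 0 \<and> arrs s ''acc'' = (\<lambda>_. 0))"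
proof -
  let ?I = "\<lambda>k s. loaded s \<and> vars s ''p'' = 3 + 2 * k \<and> order_read k s \<and>
    sets_read 0 s \<and> result s = 0 \<and> vars s ''q'' = 0 \<and> arrs s ''acc'' = (\<lambda>_. 0)"
  have "runs w (For ''k'' ''r'' read_relation) s (length rs * (loop_free_time read_relation + 8) + 6) (?I (length rs))"
  proof (rule runs_loop_free_For[where I = ?I])
    fix k s assume k: "k < length rs" and I: "?I k s" and "vars s ''k'' = k"
    obtain a b where ab: "rs ! k = (a, b)" by fastforce
    have ab_rs: "(a, b) \<in> set rs" using ab k nth_mem by metis
    have lt: "a < n" "b < n" using ab_rs rs by auto
    have read: "arrs s ''input'' (3 + 2 * k) = a" "arrs s ''input'' (Suc (3 + 2 * k)) = b"
      using I input_relation[OF k] ab by (auto simp: loaded_def)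
    have fit: "3 + 2 * k < 2 ^ w" "Suc (Suc (3 + 2 * k)) < 2 ^ w"
      using input_relation(3)[OF k] word by linarith+
    have small: "(Suc 0::nat) < 2 ^ w" "(2::nat) < 2 ^ w" "Suc a < 2 ^ w" "b < 2 ^ w" "a < 2 ^ w"
      "Suc (3 + 2 * k) < 2 ^ w"
      using lt header_small fit by linarith+
    \<comment> \<open>Each vertex has at most one predecessor, so overwriting its cell loses no
      relation.\<close>
    have order: "((arrs s ''below'')(b := Suc a)) t = Suc c \<longleftrightarrow> (c, t) \<in> set (take (Suc k) rs)" for c t
    proof (cases "t = b")
      case True
      have "c = a" if "(c, b) \<in> set (take k rs)"
        using below_unique[OF _ ab_rs] in_set_takeD[OF that] by blast
      then show ?thesis using True k ab by (auto simp: take_Suc_conv_app_nth)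
    next
      case False
      then show ?thesis using I k ab by (auto simp: take_Suc_conv_app_nth order_read_def)
    qed
    show "loop_free_wp w read_relation (\<lambda>s'. vars s' ''k'' = k \<and> ?I (Suc k) (set_var ''k'' (Suc k) s')) s"
      using I read fit small order \<open>vars s ''k'' = k\<close>
      by (simp add: read_relation_def loaded_def order_read_def sets_read_def result_def)
  qed (use assms header_small in \<open>auto simp: loaded_def order_read_def sets_read_def result_def\<close>)
  then show ?thesis
    by (rule runs_mono) (auto simp: read_relation_def offset_0)
qed

text \<open>Each size has its own destination. The empty set goes straight into
  \<open>result\<close>, which later stages can only raise; pairs are entered symmetrically, so the
  searches may meet their ends in either order.\<close>

lemma sets_step:
  assumes k: "k < length es" and s: "loaded s" "vars s ''p'' = offset k" "order_read (length rs) s"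
    "sets_read k s" "result s = of_bool ({} \<in> set ` set (take k es))"
    "vars s ''q'' = 0" "arrs s ''acc'' = (\<lambda>_. 0)" "vars s ''k'' = k"
  shows "loop_free_wp w read_set (\<lambda>s'. vars s' ''k'' = k \<and> loaded s' \<and> vars s' ''p'' = offset (Suc k) \<and>
    order_read (length rs) s' \<and> sets_read (Suc k) s' \<and>
    result s' = of_bool ({} \<in> set ` set (take (Suc k) es)) \<and>
    vars s' ''q'' = 0 \<and> arrs s' ''acc'' = (\<lambda>_. 0)) s"
proof -
  define e where "e = es ! k"
  have "e \<in> set es" using k by (simp add: e_def)
  then have e: "distinct e" "set e \<subseteq> {..<n}" "length e \<le> 2" using es by auto
  have take: "set ` set (take (Suc k) es) = insert (set e) (set ` set (take k es))"
    using k by (simp add: take_Suc_conv_app_nth e_def)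
  have read: "arrs s ''input'' (offset k + i) = (length e # e) ! i" if "i \<le> length e" for i
    using input_set[OF k] that s(1) by (simp add: loaded_def e_def)
  have len: "arrs s ''input'' (offset k) = length e" using read[of 0] by simp
  have off: "offset k + length e + 1 < 2 ^ w"
    using input_set(2)[OF k, of "length e"] word by (simp add: e_def)
  have const: "(0::nat) < 2 ^ w" "Suc 0 < (2::nat) ^ w" "(2::nat) < 2 ^ w" "offset k < 2 ^ w" "length e < 2 ^ w"
    "Suc (length e) < 2 ^ w" "Suc (offset k + length e) < 2 ^ w"
    using off header_small e(3) by linarith+
  consider "e = []" | u where "e = [u]" | u v where "e = [u, v]"
    using e(3) by (cases e rule: list.exhaust; cases "tl e" rule: list.exhaust) auto
  then show ?thesis
  proof cases
    case 1
    have "{a, b} \<noteq> set e" for a b using 1 by auto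
    then show ?thesis
      using s(1-8) len const 1
      by (simp add: read_set_def loaded_def order_read_def sets_read_def result_def offset_Suc[OF k] take flip: e_def)
  next
    case 2
    have u: "arrs s ''input'' (Suc (offset k)) = u" "u < 2 ^ w" using read[of 1] 2 e header_small by auto
    have pair: "{a, b} = set e \<longleftrightarrow> a = u \<and> b = u" for a b using 2 by auto
    show ?thesis
      using s(1-8) len const u 2 pair
      by (auto simp add: read_set_def loaded_def order_read_def sets_read_def result_def offset_Suc[OF k] take simp flip: e_def)
  next
    case 3
    have uv: "u < n" "v < n" "u \<noteq> v" using 3 e by auto
    have read': "arrs s ''input'' (Suc (offset k)) = u" "arrs s ''input'' (Suc (Suc (offset k))) = v"
      using read[of 1] read[of 2] 3 by auto
    have "u * n \<le> u * n + v" "v * n \<le> v * n + u" by auto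
    then have fit: "u < 2 ^ w" "v < 2 ^ w" "u * n + v < 2 ^ w" "v * n + u < 2 ^ w" "u * n < 2 ^ w" "v * n < 2 ^ w"
      "n < 2 ^ w" "Suc (Suc (offset k)) < 2 ^ w"
      using cell_bound[of u n v] cell_bound[of v n u] uv word header_small off 3 by (simp_all; linarith)+
    have pair: "{a, b} = set e \<longleftrightarrow> a = u \<and> b = v \<or> a = v \<and> b = u" for a b
      using 3 by (auto simp: doubleton_eq_iff)
    have single: "{a} \<noteq> set e" for a using 3 uv by auto
    have empty: "{} \<noteq> set e" using 3 by auto
    have adj: "((arrs s ''adj'')(u * n + v := Suc 0, v * n + u := Suc 0)) (a * n + b) =
        of_bool (a \<noteq> b \<and> {a, b} \<in> insert (set e) (set ` set (take k es)))" if "a < n" "b < n" for a b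
      using s(4) that pair[of a b] uv by (auto simp: sets_read_def cell_inj)
    show ?thesis
      using s(1-8) len const read' fit 3 adj single empty
      by (simp add: read_set_def cell_def loaded_def order_read_def sets_read_def result_def offset_Suc[OF k] take flip: e_def)
  qed
qed

end

context word_ram_game begin

definition parsed :: "state \<Rightarrow> bool" where
  "parsed s \<longleftrightarrow> vars s ''n'' = n \<and> order_read (length rs) s \<and> sets_read (length es) s"

lemma read_sets:
  assumes "loaded s" "vars s ''p'' = offset 0" "order_read (length rs) s"
    "sets_read 0 s \<and> result s = 0 \<and> vars s ''q'' = 0 \<and> arrs s ''acc'' = (\<lambda>_. 0)"
  shows "runs w (For ''k'' ''m'' read_set) s (length es * 52 + 6) (\<lambda>s. parsed s \<and>
    result s = of_bool ({} \<in> E) \<and> vars s ''q'' = 0 \<and> arrs s ''acc'' = (\<lambda>_. 0))"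
proof -
  let ?I = "\<lambda>k s. loaded s \<and> vars s ''p'' = offset k \<and> order_read (length rs) s \<and>
    sets_read k s \<and> result s = of_bool ({} \<in> set ` set (take k es)) \<and>
    vars s ''q'' = 0 \<and> arrs s ''acc'' = (\<lambda>_. 0)"
  have "runs w (For ''k'' ''m'' read_set) s (length es * (loop_free_time read_set + 8) + 6) (?I (length es))"
  proof (rule runs_loop_free_For[where I = ?I])
    fix k s assume k: "k < length es" and I: "?I k s" and vk: "vars s ''k'' = k"
    have upd: "loaded (set_var ''k'' (Suc k) s') = loaded s'"
      "order_read (length rs) (set_var ''k'' (Suc k) s') = order_read (length rs) s'"
      "sets_read (Suc k) (set_var ''k'' (Suc k) s') = sets_read (Suc k) s'"
      "result (set_var ''k'' (Suc k) s') = result s'" for s'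
      by (simp_all add: loaded_def order_read_def sets_read_def result_def)
    show "loop_free_wp w read_set (\<lambda>s'. vars s' ''k'' = k \<and> ?I (Suc k) (set_var ''k'' (Suc k) s')) s"
      using sets_step[OF k] I vk unfolding upd by simp
  qed (use assms header_small in \<open>auto simp: loaded_def order_read_def sets_read_def result_def\<close>)
  then show ?thesis
    by (rule runs_mono) (auto simp: read_set_def cell_def parsed_def loaded_def E_def)
qed

lemma n_small: "n < 2 ^ w" and one_small: "Suc 0 < 2 ^ w"
  using header_small by auto

lemma below_value:
  assumes "order_read (length rs) s"
  shows "arrs s ''below'' t = 0 \<or> (\<exists>b. arrs s ''below'' t = Suc b \<and> (b, t) \<in> set rs \<and> b < n \<and> t < n)"
proof (cases "arrs s ''below'' t")
  case (Suc b)
  then have "(b, t) \<in> set rs" using assms by (simp add: order_read_def)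
  then show ?thesis using Suc rs by auto
qed simp

lemma below_small:
  assumes "order_read (length rs) s"
  shows "arrs s ''below'' t < 2 ^ w"
  using below_value[OF assms, of t] n_small by auto

lemma below_zero:
  assumes "order_read (length rs) s"
  shows "arrs s ''below'' t = 0 \<longleftrightarrow> (\<forall>b. (b, t) \<notin> set rs)"
  using assms unfolding order_read_def by (metis not0_implies_Suc nat.distinct(1) take_all order_refl)

section \<open>Computing the accessible vertices\<close>

definition initially :: "nat set" where
  "initially = {i. i < n \<and> (\<forall>b. (b, i) \<notin> set rs)}"

lemma init_vertices:
  assumes "parsed s" "result s = of_bool ({} \<in> E) \<and> vars s ''q'' = 0 \<and> arrs s ''acc'' = (\<lambda>_. 0)"
  shows "runs w (For ''i'' ''n'' init_vertex) s (n * 21 + 6) (\<lambda>s. parsed s \<and>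
    result s = of_bool ({} \<in> E) \<and> vars s ''q'' = of_bool (odd n) \<and>
    arrs s ''acc'' = (\<lambda>i. of_bool (i \<in> initially)))"
proof -
  let ?I = "\<lambda>k s. parsed s \<and> result s = of_bool ({} \<in> E) \<and> vars s ''q'' = of_bool (odd k) \<and>
    arrs s ''acc'' = (\<lambda>i. of_bool (i < k \<and> (\<forall>b. (b, i) \<notin> set rs)))"
  have "runs w (For ''i'' ''n'' init_vertex) s (n * (loop_free_time init_vertex + 8) + 6) (?I n)"
  proof (rule runs_loop_free_For[where I = ?I])
    fix k s assume k: "k < n" and I: "?I k s" and vi: "vars s ''i'' = k"
    have o: "order_read (length rs) s" using I by (simp add: parsed_def)
    have "k < 2 ^ w" using k n_small by simp
    moreover have "(\<lambda>i. of_bool (i < k \<and> (\<forall>b. (b, i) \<notin> set rs)))(k := Suc 0) =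
        (\<lambda>i. of_bool (i < Suc k \<and> (\<forall>b. (b, i) \<notin> set rs)))" if "\<forall>b. (b, k) \<notin> set rs"
      using that by (auto simp: fun_eq_iff less_Suc_eq)
    moreover have "(\<lambda>i. of_bool (i < k \<and> (\<forall>b. (b, i) \<notin> set rs))) =
        (\<lambda>i. of_bool (i < Suc k \<and> (\<forall>b. (b, i) \<notin> set rs)) :: nat)" if "\<not> (\<forall>b. (b, k) \<notin> set rs)"
      using that by (auto simp: fun_eq_iff less_Suc_eq)
    ultimately show "loop_free_wp w init_vertex (\<lambda>s'. vars s' ''i'' = k \<and> ?I (Suc k) (set_var ''i'' (Suc k) s')) s"
      using I vi below_small[OF o, of k] below_zero[OF o, of k] one_small
      by (auto simp add: init_vertex_def parsed_def order_read_def sets_read_def result_def)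
  qed (use assms n_small in \<open>auto simp: parsed_def order_read_def sets_read_def result_def\<close>)
  then show ?thesis
    by (rule runs_mono) (auto simp: init_vertex_def initially_def)
qed

abbreviation "A \<equiv> accessible (set rs) {..<n} E"

text \<open>One application of the rule \<open>accessible.top\<close> with \<open>z = j\<close> and
  \<open>t = i\<close>.\<close>

definition fires :: "nat set \<Rightarrow> nat \<Rightarrow> nat \<Rightarrow> bool" where
  "fires S i j \<longleftrightarrow> j \<in> S \<and> (\<exists>b. (b, i) \<in> set rs \<and> b \<noteq> j \<and> {b, j} \<in> E)"

text \<open>Marks are set in place, so the intermediate set depends on the scanning order; it is
  only confined between \<open>initially\<close> and \<open>A\<close>.\<close>

definition marked :: "nat set \<Rightarrow> state \<Rightarrow> bool" where
  "marked S s \<longleftrightarrow> parsed s \<and> result s = of_bool ({} \<in> E) \<and> vars s ''q'' = of_bool (odd n) \<and>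
    arrs s ''acc'' = (\<lambda>i. of_bool (i \<in> S)) \<and> initially \<subseteq> S \<and> S \<subseteq> A"

lemma A_subset: "A \<subseteq> {..<n}"
  by (rule accessible_subset)

lemma A_fires: "fires S i j \<Longrightarrow> S \<subseteq> A \<Longrightarrow> i \<in> A"
  unfolding fires_def using rs by (auto intro: accessible.top)

lemma initially_unblocked: "unblocked (set rs) {..<n} v \<Longrightarrow> v \<in> initially"
  using rs by (auto simp: unblocked_def initially_def)

lemma initially_A: "initially \<subseteq> A"
  by (auto simp: initially_def unblocked_def intro!: accessible.unblocked)

text \<open>Leastness of the inductive set; it is what makes a round without change a proof of
  completion.\<close>

lemma closed_A:
  assumes "initially \<subseteq> S" "\<And>i j. i < n \<Longrightarrow> j < n \<Longrightarrow> fires S i j \<Longrightarrow> i \<in> S"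
  shows "A \<subseteq> S"
proof
  show "v \<in> S" if "v \<in> A" for v
    using that
  proof induction
    case (unblocked v)
    then show ?case using assms(1) initially_unblocked by blast
  next
    case (top z b t)
    then have "fires S t z" unfolding fires_def by blast
    moreover have "z < n" "t < n" using top A_subset by auto
    ultimately show ?case using assms(2) by blast
  qed
qed

lemma marked_set_var [simp]:
  assumes "x \<noteq> ''n''" "x \<noteq> ''q''" "x \<noteq> ''result''"
  shows "marked S (set_var x k s) = marked S s"
  using assms unfolding marked_def parsed_def order_read_def sets_read_def result_def
  by (simp only: vars_set_var arrs_set_var if_False not_sym[OF assms(1)] not_sym[OF assms(2)] not_sym[OF assms(3)])

lemma marked_n: "marked S s \<Longrightarrow> vars s ''n'' = n"
  by (simp add: marked_def parsed_def)

lemma adjacent_value: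
  assumes "parsed s" "a < n" "b < n"
  shows "arrs s ''adj'' (a * n + b) = of_bool (a \<noteq> b \<and> {a, b} \<in> E)"
  using assms by (simp add: parsed_def sets_read_def E_def)

lemma cell_small:
  assumes "a < n" "b < n"
  shows "a * n + b < 2 ^ w" "a * n < 2 ^ w"
  using cell_bound[OF assms] word by linarith+

lemma extend_step:
  assumes s: "marked S s" and ij: "i < n" "vars s ''i'' = i" "j < n" "vars s ''j'' = j"
  shows "loop_free_wp w extend (\<lambda>s'. marked (if fires S i j then insert i S else S) s' \<and>
    vars s' ''i'' = i \<and> vars s' ''j'' = j \<and> vars s' ''k'' = vars s ''k'') s"
proof -
  have p: "parsed s" and o: "order_read (length rs) s" and acc: "arrs s ''acc'' = (\<lambda>i. of_bool (i \<in> S))"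
    and SA: "S \<subseteq> A"
    using s by (auto simp: marked_def parsed_def)
  have vn: "vars s ''n'' = n" using p by (simp add: parsed_def)
  have small: "i < 2 ^ w" "j < 2 ^ w" using ij n_small by auto
  have "0 < n" using ij by simp
  then have pred: "arrs s ''below'' i - Suc 0 < n" using below_value[OF o, of i] by auto
  have cond: "arrs s ''below'' i \<noteq> 0 \<and> j \<in> S \<and>
      arrs s ''adj'' ((arrs s ''below'' i - Suc 0) * n + j) = Suc 0 \<longleftrightarrow> fires S i j"
    using below_value[OF o, of i]
  proof (elim disjE exE conjE)
    assume "arrs s ''below'' i = 0"
    then show ?thesis using below_zero[OF o, of i] by (auto simp: fires_def)
  next
    fix b assume b: "arrs s ''below'' i = Suc b" "(b, i) \<in> set rs" "b < n"
    then have "(c, i) \<in> set rs \<longleftrightarrow> c = b" for c using below_unique by blast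
    then have "fires S i j \<longleftrightarrow> j \<in> S \<and> b \<noteq> j \<and> {b, j} \<in> E" by (simp add: fires_def)
    then show ?thesis
      using b adjacent_value[OF p b(3) ij(3)] by simp
  qed
  have adj_small: "arrs s ''adj'' ((arrs s ''below'' i - Suc 0) * n + j) < 2 ^ w"
    using adjacent_value[OF p pred ij(3)] one_small by simp
  show ?thesis
  proof (cases "fires S i j")
    case True
    have "(\<lambda>i. of_bool (i \<in> S))(i := Suc 0) = (\<lambda>x. of_bool (x \<in> insert i S))" by auto
    moreover have "marked (insert i S) (s\<lparr>arrs := (arrs s)(''acc'' := \<lambda>x. of_bool (x \<in> insert i S))\<rparr>)"
      using s A_fires[OF True SA] unfolding marked_def parsed_def order_read_def sets_read_def result_def
      by auto
    ultimately show ?thesis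
      using True cond acc ij small one_small below_small[OF o, of i] cell_small[OF pred ij(3)] vn adj_small n_small
        pred by (simp add: extend_def cell_def)
  next
    case False
    then show ?thesis
      using cond acc ij small one_small below_small[OF o, of i] cell_small[OF pred ij(3)] vn adj_small n_small
        s pred by (auto simp add: extend_def cell_def)
  qed
qed

text \<open>Progress is measured against the snapshot \<open>S0\<close> taken at the start of the
  round. Marks set in between only enable more steps, so every step that fires from
  \<open>S0\<close> is carried out.\<close>

lemma extend_row:
  assumes "marked S s" "i < n" "vars s ''i'' = i" "S0 \<subseteq> S"
  shows "runs w (For ''j'' ''n'' extend) s (n * 34 + 6) (\<lambda>s'. vars s' ''i'' = i \<and> vars s' ''k'' = vars s ''k'' \<and>
    (\<exists>S'. marked S' s' \<and> S \<subseteq> S' \<and> (\<forall>j<n. fires S0 i j \<longrightarrow> i \<in> S')))"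
proof -
  let ?I = "\<lambda>k s'. vars s' ''i'' = i \<and> vars s' ''k'' = vars s ''k'' \<and>
    (\<exists>S'. marked S' s' \<and> S \<subseteq> S' \<and> (\<forall>j<k. fires S0 i j \<longrightarrow> i \<in> S'))"
  have "runs w (For ''j'' ''n'' extend) s (n * (loop_free_time extend + 8) + 6) (?I n)"
  proof (rule runs_For[where I = ?I])
    fix k s1 assume k: "k < n" "?I k s1" "vars s1 ''j'' = k"
    then obtain S' where S': "marked S' s1" "S \<subseteq> S'" "\<forall>j<k. fires S0 i j \<longrightarrow> i \<in> S'" by blast
    let ?S = "if fires S' i k then insert i S' else S'"
    have "fires S' i k" if "fires S0 i k" using that assms(4) S'(2) by (auto simp: fires_def)
    then have "\<forall>j<Suc k. fires S0 i j \<longrightarrow> i \<in> ?S" using S'(3) by (auto simp: less_Suc_eq)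
    moreover have "S \<subseteq> ?S" using S'(2) by auto
    ultimately have *: "\<exists>S'. marked S' s' \<and> S \<subseteq> S' \<and> (\<forall>j<Suc k. fires S0 i j \<longrightarrow> i \<in> S')"
      if "marked ?S s'" for s' using that by blast
    show "runs w extend s1 (loop_free_time extend) (\<lambda>s'. vars s' ''j'' = k \<and> ?I (Suc k) (set_var ''j'' (Suc k) s'))"
    proof (rule runs_mono[OF runs_loop_free[OF extend_step[OF S'(1) assms(2) _ k(1,3)]]])
      fix s' assume s': "marked ?S s' \<and> vars s' ''i'' = i \<and> vars s' ''j'' = k \<and> vars s' ''k'' = vars s1 ''k''"
      then show "vars s' ''j'' = k \<and> ?I (Suc k) (set_var ''j'' (Suc k) s')"
        using *[of "set_var ''j'' (Suc k) s'"] k(2) by simp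
    qed (use k in simp_all)
  qed (use assms n_small marked_n in auto)
  then show ?thesis by (rule runs_mono) (auto simp: extend_def cell_def)
qed

lemma extend_round:
  assumes "marked S0 s"
  shows "runs w (For ''i'' ''n'' (For ''j'' ''n'' extend)) s (n * (n * 34 + 14) + 6) (\<lambda>s'. vars s' ''k'' = vars s ''k'' \<and>
    (\<exists>S'. marked S' s' \<and> S0 \<subseteq> S' \<and> (\<forall>i<n. \<forall>j<n. fires S0 i j \<longrightarrow> i \<in> S')))"
proof -
  let ?I = "\<lambda>k s'. vars s' ''k'' = vars s ''k'' \<and>
    (\<exists>S'. marked S' s' \<and> S0 \<subseteq> S' \<and> (\<forall>i<k. \<forall>j<n. fires S0 i j \<longrightarrow> i \<in> S'))"
  have "runs w (For ''i'' ''n'' (For ''j'' ''n'' extend)) s (n * ((n * 34 + 6) + 8) + 6) (?I n)"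
  proof (rule runs_For[where I = ?I])
    fix k s1 assume k: "k < n" "?I k s1" "vars s1 ''i'' = k"
    then obtain S where S: "marked S s1" "S0 \<subseteq> S" "\<forall>i<k. \<forall>j<n. fires S0 i j \<longrightarrow> i \<in> S" by blast
    have *: "\<exists>S''. marked S'' s' \<and> S0 \<subseteq> S'' \<and> (\<forall>i<Suc k. \<forall>j<n. fires S0 i j \<longrightarrow> i \<in> S'')"
      if "marked S' s'" "S \<subseteq> S'" "\<forall>j<n. fires S0 k j \<longrightarrow> k \<in> S'" for s' S'
      using that S(2,3) by (intro exI[of _ S']) (auto simp: less_Suc_eq)
    show "runs w (For ''j'' ''n'' extend) s1 (n * 34 + 6)
        (\<lambda>s'. vars s' ''i'' = k \<and> ?I (Suc k) (set_var ''i'' (Suc k) s'))"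
    proof (rule runs_mono[OF extend_row[OF S(1) k(1,3) S(2)]])
      fix s' assume s': "vars s' ''i'' = k \<and> vars s' ''k'' = vars s1 ''k'' \<and>
        (\<exists>S'. marked S' s' \<and> S \<subseteq> S' \<and> (\<forall>j<n. fires S0 k j \<longrightarrow> k \<in> S'))"
      then obtain S' where "marked S' s'" "S \<subseteq> S'" "\<forall>j<n. fires S0 k j \<longrightarrow> k \<in> S'" by blast
      then show "vars s' ''i'' = k \<and> ?I (Suc k) (set_var ''i'' (Suc k) s')"
        using *[of S' "set_var ''i'' (Suc k) s'"] k(2) s' by simp
    qed simp
  qed (use assms n_small marked_n in auto)
  then show ?thesis by (rule runs_mono) auto
qed

lemma finite_marked: "marked S s \<Longrightarrow> finite S"
  using finite_subset[OF subset_trans[OF _ A_subset]] by (simp add: marked_def)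

text \<open>A round that adds no vertex has reached the closure, so \<open>n\<close> rounds suffice.\<close>

lemma runs_closure:
  assumes "marked initially s"
  shows "runs w (For ''k'' ''n'' (For ''i'' ''n'' (For ''j'' ''n'' extend))) s
    (n * (n * (n * 34 + 14) + 14) + 6) (marked A)"
proof -
  let ?I = "\<lambda>k s'. \<exists>S. marked S s' \<and> (S = A \<or> k \<le> card S)"
  have "runs w (For ''k'' ''n'' (For ''i'' ''n'' (For ''j'' ''n'' extend))) s
    (n * ((n * (n * 34 + 14) + 6) + 8) + 6) (?I n)"
  proof (rule runs_For[where I = ?I])
    fix k s1 assume k: "k < n" "?I k s1" "vars s1 ''k'' = k"
    then obtain S where S: "marked S s1" "S = A \<or> k \<le> card S" by blast
    have *: "\<exists>S'. marked S' s' \<and> (S' = A \<or> Suc k \<le> card S')"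
      if S': "marked S' s'" "S \<subseteq> S'" "\<forall>i<n. \<forall>j<n. fires S i j \<longrightarrow> i \<in> S'" for s' S'
    proof (intro exI conjI)
      have SA: "S' \<subseteq> A" "initially \<subseteq> S" using S' S by (auto simp: marked_def)
      show "S' = A \<or> Suc k \<le> card S'"
      proof (cases "S' = S")
        case True
        then have "A \<subseteq> S" using S' SA by (intro closed_A) auto
        then show ?thesis using True SA by auto
      next
        case False
        then have "card S < card S'" using S' finite_marked by (intro psubset_card_mono) auto
        then show ?thesis using S(2) S'(2) SA by auto
      qed
    qed fact
    show "runs w (For ''i'' ''n'' (For ''j'' ''n'' extend)) s1 (n * (n * 34 + 14) + 6)
        (\<lambda>s'. vars s' ''k'' = k \<and> ?I (Suc k) (set_var ''k'' (Suc k) s'))"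
    proof (rule runs_mono[OF extend_round[OF S(1)]])
      fix s' assume s': "vars s' ''k'' = vars s1 ''k'' \<and>
        (\<exists>S'. marked S' s' \<and> S \<subseteq> S' \<and> (\<forall>i<n. \<forall>j<n. fires S i j \<longrightarrow> i \<in> S'))"
      then obtain S' where "marked S' s'" "S \<subseteq> S'" "\<forall>i<n. \<forall>j<n. fires S i j \<longrightarrow> i \<in> S'" by blast
      then show "vars s' ''k'' = k \<and> ?I (Suc k) (set_var ''k'' (Suc k) s')"
        using *[of S' "set_var ''k'' (Suc k) s'"] k(3) s' by simp
    qed simp
  qed (use assms n_small marked_n in auto)
  then show ?thesis
  proof (rule runs_mono)
    fix s' assume "?I n s'"
    then obtain S where S: "marked S s'" "S = A \<or> n \<le> card S" by blast
    \<comment> \<open>If \<open>S\<close> has \<open>n\<close> elements, it is the whole board, and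
      \<open>A\<close> is squeezed between the two.\<close>
    have "S = A"
    proof (cases "S = A")
      case False
      then have "card {..<n} \<le> card S" using S by simp
      moreover have "S \<subseteq> {..<n}" using S A_subset by (auto simp: marked_def)
      ultimately have "S = {..<n}" by (intro card_seteq) auto
      then show ?thesis using S A_subset by (auto simp: marked_def)
    qed
    then show "marked A s'" using S by simp
  qed simp
qed

section \<open>The three searches\<close>

text \<open>Says nothing about \<open>result\<close>, because the searches that preserve it change
  that flag.\<close>

definition final :: "state \<Rightarrow> bool" where
  "final s \<longleftrightarrow> parsed s \<and> vars s ''q'' = of_bool (odd n) \<and> arrs s ''acc'' = (\<lambda>i. of_bool (i \<in> A))"

lemma final_set_var [simp]:
  assumes "x \<noteq> ''n''" "x \<noteq> ''q''"
  shows "final (set_var x k s) = final s"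
  unfolding final_def parsed_def order_read_def sets_read_def
  by (simp only: vars_set_var arrs_set_var if_False not_sym[OF assms(1)] not_sym[OF assms(2)])

lemma final_facts:
  assumes "final s"
  shows "vars s ''n'' = n" "vars s ''q'' = of_bool (odd n)" "arrs s ''acc'' i = of_bool (i \<in> A)"
    "arrs s ''unit'' i = of_bool ({i} \<in> E)" "parsed s" "order_read (length rs) s"
  using assms by (auto simp: final_def parsed_def sets_read_def E_def)

lemma check_units:
  "searches w (For ''i'' ''n'' (report unit_guard)) (n * 22 + 6) final
    (\<exists>i<n. {i} \<in> E \<and> (i \<in> A \<or> odd n))"
proof -
  have "searches w (For ''i'' ''n'' (report unit_guard)) (n * ((3 + bcost unit_guard) + 8) + 6) final
    (\<exists>i<n. {i} \<in> E \<and> (i \<in> A \<or> odd n))"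
    unfolding report_def
  proof (rule searches_For)
    fix k assume k: "k < n"
    show "searches w (Cond unit_guard (Assign ''result'' (Const 1)) Skip) (3 + bcost unit_guard)
      (\<lambda>s. final s \<and> vars s ''i'' = k) ({k} \<in> E \<and> (k \<in> A \<or> odd n))"
    proof (rule searches_Cond)
      fix s assume "final s \<and> vars s ''i'' = k"
      then show "bfits w unit_guard s \<and> (bval unit_guard s \<longleftrightarrow> {k} \<in> E \<and> (k \<in> A \<or> odd n))"
        using k n_small header_small(4) final_facts[of s]
        by (auto simp: unit_guard_def)
    qed (use one_small in \<open>auto simp: Suc_le_eq intro: ccontr\<close>)
  qed (use n_small final_facts in auto)
  then show ?thesis by (simp add: unit_guard_def)
qed

lemma check_forks:
  "searches w (For ''i'' ''n'' (For ''j'' ''n'' (For ''k'' ''n'' (report fork_guard))))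
    (n * (n * (n * 48 + 14) + 14) + 6) final
    (\<exists>i<n. \<exists>j<n. \<exists>k<n. i \<in> A \<and> j \<in> A \<and> k \<in> A \<and> i \<noteq> j \<and> {i, j} \<in> E \<and> i \<noteq> k \<and> {i, k} \<in> E \<and> j \<noteq> k)"
proof -
  have "searches w (For ''i'' ''n'' (For ''j'' ''n'' (For ''k'' ''n'' (report fork_guard))))
    (n * ((n * ((n * ((3 + bcost fork_guard) + 8) + 6) + 8) + 6) + 8) + 6) final
    (\<exists>i<n. \<exists>j<n. \<exists>k<n. i \<in> A \<and> j \<in> A \<and> k \<in> A \<and> i \<noteq> j \<and> {i, j} \<in> E \<and> i \<noteq> k \<and> {i, k} \<in> E \<and> j \<noteq> k)"
    unfolding report_def
  proof (intro searches_For)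
    fix i j k assume ijk: "i < n" "j < n" "k < n"
    show "searches w (Cond fork_guard (Assign ''result'' (Const 1)) Skip) (3 + bcost fork_guard)
      (\<lambda>s. ((final s \<and> vars s ''i'' = i) \<and> vars s ''j'' = j) \<and> vars s ''k'' = k)
      (i \<in> A \<and> j \<in> A \<and> k \<in> A \<and> i \<noteq> j \<and> {i, j} \<in> E \<and> i \<noteq> k \<and> {i, k} \<in> E \<and> j \<noteq> k)"
    proof (rule searches_Cond)
      fix s assume s: "((final s \<and> vars s ''i'' = i) \<and> vars s ''j'' = j) \<and> vars s ''k'' = k"
      then have f: "final s" by simp
      show "bfits w fork_guard s \<and> (bval fork_guard s \<longleftrightarrow>
        i \<in> A \<and> j \<in> A \<and> k \<in> A \<and> i \<noteq> j \<and> {i, j} \<in> E \<and> i \<noteq> k \<and> {i, k} \<in> E \<and> j \<noteq> k)"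
        using s ijk n_small one_small final_facts[OF f] cell_small[of i j] cell_small[of i k]
          adjacent_value[of s i j] adjacent_value[of s i k]
        by (auto simp: fork_guard_def cell_def)
    qed (use one_small in \<open>auto simp: Suc_le_eq intro: ccontr\<close>)
  qed (use n_small final_facts in auto)
  then show ?thesis by (simp add: fork_guard_def cell_def add.commute)
qed

lemma check_tops:
  "searches w (For ''i'' ''n'' (For ''j'' ''n'' (report top_guard))) (n * (n * 37 + 14) + 6) final
    (\<exists>i<n. \<exists>j<n. odd n \<and> i \<noteq> j \<and> {i, j} \<in> E \<and> (\<exists>b. (b, j) \<in> set rs \<and> b \<noteq> i))"
proof -
  have "searches w (For ''i'' ''n'' (For ''j'' ''n'' (report top_guard)))
    (n * ((n * ((3 + bcost top_guard) + 8) + 6) + 8) + 6) final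
    (\<exists>i<n. \<exists>j<n. odd n \<and> i \<noteq> j \<and> {i, j} \<in> E \<and> (\<exists>b. (b, j) \<in> set rs \<and> b \<noteq> i))"
    unfolding report_def
  proof (intro searches_For)
    fix i j assume ij: "i < n" "j < n"
    show "searches w (Cond top_guard (Assign ''result'' (Const 1)) Skip) (3 + bcost top_guard)
      (\<lambda>s. (final s \<and> vars s ''i'' = i) \<and> vars s ''j'' = j)
      (odd n \<and> i \<noteq> j \<and> {i, j} \<in> E \<and> (\<exists>b. (b, j) \<in> set rs \<and> b \<noteq> i))"
    proof (rule searches_Cond)
      fix s assume s: "(final s \<and> vars s ''i'' = i) \<and> vars s ''j'' = j"
      then have f: "final s" by simp
      note o = final_facts(6)[OF f]
      have "arrs s ''below'' j \<noteq> 0 \<and> arrs s ''below'' j \<noteq> Suc i \<longleftrightarrow> (\<exists>b. (b, j) \<in> set rs \<and> b \<noteq> i)"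
        using below_value[OF o, of j]
      proof (elim disjE exE conjE)
        fix b assume b: "arrs s ''below'' j = Suc b" "(b, j) \<in> set rs"
        then have "(c, j) \<in> set rs \<longleftrightarrow> c = b" for c using below_unique by blast
        then show ?thesis using b by simp
      qed (use below_zero[OF o, of j] in simp)
      then show "bfits w top_guard s \<and> (bval top_guard s \<longleftrightarrow>
        odd n \<and> i \<noteq> j \<and> {i, j} \<in> E \<and> (\<exists>b. (b, j) \<in> set rs \<and> b \<noteq> i))"
        using s ij n_small header_small(4,5) one_small final_facts[OF f] cell_small[of i j] adjacent_value[of s i j]
          below_small[OF o, of j]
        by (auto simp: top_guard_def cell_def)
    qed (use one_small in \<open>auto simp: Suc_le_eq intro: ccontr\<close>)
  qed (use n_small final_facts in auto)
  then show ?thesis by (simp add: top_guard_def cell_def add.commute)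
qed

end

section \<open>Correctness and running time\<close>

context numbered_game begin

section \<open>The criterion as bounded search, and the size of the input\<close>

lemma E_subset: "E \<subseteq> Pow {..<n}"
  using es by (auto simp: E_def)

text \<open>Brings the criterion into the form delivered by the loops. Bounding the quantifiers is
  harmless, as accessible vertices and elements of winning sets are below \<open>n\<close>.\<close>

lemma criterion_numbered:
  "maker_criterion (set rs) {..<n} E \<longleftrightarrow> {} \<in> E \<or>
    (\<exists>i<n. {i} \<in> E \<and> (i \<in> accessible (set rs) {..<n} E \<or> odd n)) \<or>
    (\<exists>i<n. \<exists>j<n. \<exists>k<n. i \<in> accessible (set rs) {..<n} E \<and> j \<in> accessible (set rs) {..<n} E \<and>
      k \<in> accessible (set rs) {..<n} E \<and> i \<noteq> j \<and> {i, j} \<in> E \<and> i \<noteq> k \<and> {i, k} \<in> E \<and> j \<noteq> k) \<or>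
    (\<exists>i<n. \<exists>j<n. odd n \<and> i \<noteq> j \<and> {i, j} \<in> E \<and> (\<exists>b. (b, j) \<in> set rs \<and> b \<noteq> i))"
    (is "_ \<longleftrightarrow> _ \<or> ?unit \<or> ?fork \<or> ?top")
proof -
  let ?A = "accessible (set rs) {..<n} E"
  have A: "i < n" if "i \<in> ?A" for i using subsetD[OF accessible_subset that] by simp
  have E1: "i < n" if "{i} \<in> E" for i using that E_subset by auto
  have E2: "i < n" "j < n" if "{i, j} \<in> E" for i j using that E_subset by auto
  have "?unit \<longleftrightarrow> (\<exists>v\<in>?A. {v} \<in> E) \<or> odd n \<and> (\<exists>v. {v} \<in> E)"
    using E1 by blast
  moreover have "?fork \<longleftrightarrow> (\<exists>v\<in>?A. \<exists>u\<in>?A. \<exists>w\<in>?A. v \<noteq> u \<and> v \<noteq> w \<and> u \<noteq> w \<and> {v, u} \<in> E \<and> {v, w} \<in> E)"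
    using A by blast
  moreover have "?top \<longleftrightarrow> odd n \<and> (\<exists>p b t. (b, t) \<in> set rs \<and> p \<noteq> t \<and> p \<noteq> b \<and> {p, t} \<in> E)"
    using E2 by blast
  ultimately show ?thesis
    unfolding maker_criterion_def double_threat_def by (simp only: card_lessThan) blast
qed

lemma length_rs_le: "distinct rs \<Longrightarrow> length rs \<le> n * n"
  using card_mono[OF _ rs] distinct_card[of rs] by (simp add: card_cartesian_product)

text \<open>A nonempty winning set is \<open>{a, b}\<close> with \<open>a = b\<close> allowed, hence
  an image of a point of the square; the empty set contributes the extra 1.\<close>

lemma length_es_le:
  assumes "distinct (map set es)"
  shows "length es \<le> n * n + 1"
proof -
  let ?S = "insert {} ((\<lambda>(a, b). {a, b}) ` ({..<n} \<times> {..<n}))"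
  have "set (map set es) \<subseteq> ?S"
  proof
    fix S assume "S \<in> set (map set es)"
    then obtain e where e: "e \<in> set es" "S = set e" by auto
    then have "set e \<subseteq> {..<n}" "length e \<le> 2" using es by auto
    then consider "e = []" | u where "e = [u]" "u < n" | u v where "e = [u, v]" "u < n" "v < n"
      by (cases e rule: list.exhaust; cases "tl e" rule: list.exhaust) auto
    then show "S \<in> ?S"
    proof cases
      case 2
      then have "S = (\<lambda>(a, b). {a, b}) (u, u)" using e by simp
      then show ?thesis using 2 by blast
    next
      case 3
      then have "S = (\<lambda>(a, b). {a, b}) (u, v)" using e by simp
      then show ?thesis using 3 by blast
    qed (use e in simp)
  qed
  then have "length es \<le> card ?S"
    using card_mono[of ?S "set (map set es)"] distinct_card[OF assms] by simp
  also have "\<dots> \<le> Suc (card ((\<lambda>(a, b). {a, b}) ` ({..<n} \<times> {..<n})))"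
    by (rule card_insert_le_m1) simp_all
  also have "\<dots> \<le> Suc (card ({..<n} \<times> {..<n}))"
    by (intro Suc_le_mono[THEN iffD2] card_image_le) simp
  finally show ?thesis by (simp add: card_cartesian_product)
qed

lemma length_input_le: "length input \<le> 3 + 2 * length rs + 3 * length es"
proof -
  have "length (concat (map (\<lambda>e. length e # e) xs)) \<le> 3 * length xs" if "set xs \<subseteq> set es" for xs
    using that
  proof (induction xs)
    case (Cons e xs)
    then show ?case using es[of e] by simp
  qed simp
  then show ?thesis using length_rs[of rs] by (simp add: input_def)
qed

end

lemma runs_searches:
  assumes "searches w c t F \<phi>" "F s" "result s = of_bool b"
  shows "runs w c s t (\<lambda>s'. F s' \<and> result s' = of_bool (b \<or> \<phi>))"
  using assms unfolding searches_def by blast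

text \<open>One summand per stage of \<open>decide\<close>; the cubic ones belong to the closure and
  to the search for forks.\<close>

definition decide_time :: "nat \<Rightarrow> nat \<Rightarrow> nat \<Rightarrow> nat" where
  "decide_time n r m = 11 + ((r * 21 + 6) + ((m * 52 + 6) + ((n * 21 + 6) +
    ((n * (n * (n * 34 + 14) + 14) + 6) + ((n * 22 + 6) +
    ((n * (n * (n * 48 + 14) + 14) + 6) + (n * (n * 37 + 14) + 6)))))))"

lemma (in word_ram_game) runs_decide:
  "runs w decide (initial_state input) (decide_time n (length rs) (length es))
    (\<lambda>s. result s = of_bool (maker_criterion (set rs) {..<n} E))"
  unfolding decide_def decide_time_def
proof (rule runs_Seq[OF runs_read_header], elim conjE, rule runs_Seq[OF read_order], assumption+, blast,
    elim conjE, rule runs_Seq[OF read_sets], assumption+, blast,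
    elim conjE, rule runs_Seq[OF init_vertices], assumption+, blast,
    rule runs_Seq[OF runs_closure])
  fix s assume "parsed s \<and> result s = of_bool ({} \<in> E) \<and> vars s ''q'' = of_bool (odd n) \<and>
    arrs s ''acc'' = (\<lambda>i. of_bool (i \<in> initially))"
  then show "marked initially s" using initially_A by (simp add: marked_def)
next
  fix s assume "marked A s"
  then have s: "final s" "result s = of_bool ({} \<in> E)" by (auto simp: marked_def final_def)
  show "runs w (Seq (For ''i'' ''n'' (report unit_guard))
      (Seq (For ''i'' ''n'' (For ''j'' ''n'' (For ''k'' ''n'' (report fork_guard))))
           (For ''i'' ''n'' (For ''j'' ''n'' (report top_guard))))) s
     ((n * 22 + 6) + ((n * (n * (n * 48 + 14) + 14) + 6) + (n * (n * 37 + 14) + 6)))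
     (\<lambda>s. result s = of_bool (maker_criterion (set rs) {..<n} E))"
    apply (rule runs_Seq[OF runs_searches[OF check_units s]])
    apply (elim conjE)
    apply (rule runs_Seq[OF runs_searches[OF check_forks]], assumption+)
    apply (elim conjE)
    apply (rule runs_mono[OF runs_searches[OF check_tops]], assumption+)
     apply simp
    unfolding criterion_numbered by (simp only: disj_assoc)
qed

section \<open>Invariance under renumbering\<close>

lemma accessible_image:
  assumes inj: "inj_on \<nu> X" and L: "L \<subseteq> X \<times> X" and "v \<in> accessible L X E"
  shows "\<nu> v \<in> accessible (map_prod \<nu> \<nu> ` L) (\<nu> ` X) (image \<nu> ` E)"
  using assms(3)
proof induction
  case (unblocked v)
  have "(u, \<nu> v) \<notin> map_prod \<nu> \<nu> ` L" for u
  proof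
    assume "(u, \<nu> v) \<in> map_prod \<nu> \<nu> ` L"
    then obtain a c where ac: "(a, c) \<in> L" "\<nu> v = \<nu> c" by auto
    then have "v = c" using inj L unblocked by (auto simp: unblocked_def inj_on_def)
    then show False using unblocked ac L by (auto simp: unblocked_def)
  qed
  then show ?case using unblocked by (intro accessible.unblocked) (auto simp: unblocked_def)
next
  case (top z b t)
  have "z \<in> X" using subsetD[OF accessible_subset top(1)] .
  then have "\<nu> b \<noteq> \<nu> z" using inj top by (auto simp: inj_on_def)
  moreover have "{\<nu> b, \<nu> z} \<in> image \<nu> ` E" using top(2) by (intro image_eqI[of _ _ "{b, z}"]) auto
  moreover have "(\<nu> b, \<nu> t) \<in> map_prod \<nu> \<nu> ` L" using top(5) by force
  ultimately show ?case using top by (intro accessible.top[OF top.IH, of "\<nu> b"]) auto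
qed

lemma maker_criterion_image:
  assumes inj: "inj_on \<nu> X" and L: "L \<subseteq> X \<times> X" and E: "E \<subseteq> Pow X" and "maker_criterion L X E"
  shows "maker_criterion (map_prod \<nu> \<nu> ` L) (\<nu> ` X) (image \<nu> ` E)"
proof -
  let ?L = "map_prod \<nu> \<nu> ` L" and ?E = "image \<nu> ` E"
  note acc = accessible_image[OF inj L]
  have one: "{\<nu> v} \<in> ?E" if "{v} \<in> E" for v
    using that by (intro image_eqI[of _ _ "{v}"]) auto
  have two: "{\<nu> u, \<nu> v} \<in> ?E" "\<nu> u \<noteq> \<nu> v" if "{u, v} \<in> E" "u \<noteq> v" for u v
    using that E inj by (auto simp: inj_on_def intro!: image_eqI[of _ _ "{u, v}"])
  have ne: "\<nu> u \<noteq> \<nu> v" if "u \<in> X" "v \<in> X" "u \<noteq> v" for u v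
    using that inj by (auto simp: inj_on_def)
  show ?thesis
  proof (cases "double_threat L X E")
    case True
    then consider "{} \<in> E" | v where "v \<in> accessible L X E" "{v} \<in> E"
      | v u w where "v \<in> accessible L X E" "u \<in> accessible L X E" "w \<in> accessible L X E"
          "v \<noteq> u" "v \<noteq> w" "u \<noteq> w" "{v, u} \<in> E" "{v, w} \<in> E"
      unfolding double_threat_def by blast
    then have "double_threat ?L (\<nu> ` X) ?E"
    proof cases
      case 1
      then have "{} \<in> ?E" by force
      then show ?thesis by (simp add: double_threat_def)
    next
      case 2
      then show ?thesis using acc[OF 2(1)] one[OF 2(2)] unfolding double_threat_def by blast
    next
      case 3
      have "\<nu> u \<noteq> \<nu> w"
        using ne[OF subsetD[OF accessible_subset 3(2)] subsetD[OF accessible_subset 3(3)] 3(6)] .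
      then show ?thesis
        using acc[OF 3(1)] acc[OF 3(2)] acc[OF 3(3)] two[OF 3(7,4)] two[OF 3(8,5)]
        unfolding double_threat_def by blast
    qed
    then show ?thesis by (simp add: maker_criterion_def)
  next
    case False
    then have odd: "odd (card X)" and "(\<exists>v. {v} \<in> E) \<or> (\<exists>p b t. (b, t) \<in> L \<and> p \<noteq> t \<and> p \<noteq> b \<and> {p, t} \<in> E)"
      using assms(4) by (auto simp: maker_criterion_def)
    then consider v where "{v} \<in> E" | p b t where "(b, t) \<in> L" "p \<noteq> t" "p \<noteq> b" "{p, t} \<in> E"
      by blast
    then have "(\<exists>v. {v} \<in> ?E) \<or> (\<exists>p b t. (b, t) \<in> ?L \<and> p \<noteq> t \<and> p \<noteq> b \<and> {p, t} \<in> ?E)"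
    proof cases
      case 1
      then show ?thesis using one by blast
    next
      case 2
      have "p \<in> X" "b \<in> X" using 2 E L by auto
      then have "\<nu> p \<noteq> \<nu> b" using ne 2 by blast
      moreover have "(\<nu> b, \<nu> t) \<in> ?L" using 2 by force
      ultimately have "(\<nu> b, \<nu> t) \<in> ?L \<and> \<nu> p \<noteq> \<nu> t \<and> \<nu> p \<noteq> \<nu> b \<and> {\<nu> p, \<nu> t} \<in> ?E"
        using two[OF 2(4,2)] by simp
      then show ?thesis by (intro disjI2 exI)
    qed
    then show ?thesis using odd card_image[OF inj] by (simp add: maker_criterion_def)
  qed
qed

text \<open>The converse is the forward direction for the inverse numbering, which undoes all three
  images.\<close>

lemma maker_criterion_iso:
  assumes inj: "inj_on \<nu> X" and L: "L \<subseteq> X \<times> X" and E: "E \<subseteq> Pow X"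
  shows "maker_criterion (map_prod \<nu> \<nu> ` L) (\<nu> ` X) (image \<nu> ` E) \<longleftrightarrow> maker_criterion L X E"
proof
  let ?\<mu> = "the_inv_into X \<nu>"
  have inv: "?\<mu> (\<nu> x) = x" if "x \<in> X" for x using the_inv_into_f_f[OF inj that] .
  have "map_prod ?\<mu> ?\<mu> ` map_prod \<nu> \<nu> ` L = L"
  proof -
    have "map_prod ?\<mu> ?\<mu> (map_prod \<nu> \<nu> x) = x" if "x \<in> L" for x
      using that L inv by (cases x) auto
    then show ?thesis by (simp add: image_image)
  qed
  moreover have "?\<mu> ` \<nu> ` S = S" if "S \<subseteq> X" for S
    using inv that by (simp add: image_image subset_iff)
  then have "?\<mu> ` \<nu> ` X = X" "image ?\<mu> ` image \<nu> ` E = E"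
    using E by (simp_all add: image_image Pow_def subset_iff)
  moreover assume crit: "maker_criterion (map_prod \<nu> \<nu> ` L) (\<nu> ` X) (image \<nu> ` E)"
  have "maker_criterion (map_prod ?\<mu> ?\<mu> ` map_prod \<nu> \<nu> ` L) (?\<mu> ` \<nu> ` X) (image ?\<mu> ` image \<nu> ` E)"
    by (rule maker_criterion_image[OF inj_on_the_inv_into[OF inj] _ _ crit]) (use L E in auto)
  ultimately show "maker_criterion L X E" by simp
qed (rule maker_criterion_image[OF assms])

text \<open>Comparable vertices share a block of the partition, and a block of at most two elements
  containing \<open>b\<close> and \<open>t\<close> is \<open>{b, t}\<close>; antisymmetry does the
  rest.\<close>

lemma two_level_disjoint_chains:
  assumes game: "poset_positional_game X F P" and chains: "disjoint_chains X P 2"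
  shows "two_level (P - Id)" "P - Id \<subseteq> X \<times> X"
proof -
  have fin: "finite X" and PX: "P \<subseteq> X \<times> X" and an: "antisym P"
    using game by (auto simp: poset_positional_game_def partial_order_on_def preorder_on_def refl_on_def)
  obtain \<C> where part: "partition_on X \<C>" and small: "\<And>C. C \<in> \<C> \<Longrightarrow> card C \<le> 2"
    and incomparable: "\<And>C D x y. C \<in> \<C> \<Longrightarrow> D \<in> \<C> \<Longrightarrow> C \<noteq> D \<Longrightarrow> x \<in> C \<Longrightarrow> y \<in> D \<Longrightarrow> (x, y) \<notin> P"
    using chains unfolding disjoint_chains_def by metis
  have pair: "(b', t) \<in> P - Id \<Longrightarrow> b' = b" "(b, t') \<in> P - Id \<Longrightarrow> t' = t" "(t, c) \<notin> P - Id"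
    if bt: "(b, t) \<in> P - Id" for b t b' t' c
  proof -
    have "b \<in> X" "t \<in> X" using bt PX by auto
    then obtain C where C: "C \<in> \<C>" "b \<in> C" using partition_onD1[OF part] by blast
    have same: "y \<in> C" if "x \<in> C" "(x, y) \<in> P \<or> (y, x) \<in> P" for x y
    proof -
      have "y \<in> X" using that PX by auto
      then obtain D where "D \<in> \<C>" "y \<in> D" using partition_onD1[OF part] by blast
      then show ?thesis using incomparable[of C D x y] incomparable[of D C y x] C that by blast
    qed
    have t: "t \<in> C" "b \<noteq> t" using same[of b t] C bt by auto
    have "finite C" using C partition_onD1[OF part] fin by (metis Sup_upper finite_subset)
    have "C = {b, t}"
      using card_seteq[OF \<open>finite C\<close>, of "{b, t}"] C t small[OF C(1)] by simp
    then show "(b', t) \<in> P - Id \<Longrightarrow> b' = b" "(b, t') \<in> P - Id \<Longrightarrow> t' = t" "(t, c) \<notin> P - Id"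
      using same[of t b'] same[of b t'] same[of t c] bt an C t by (auto simp: antisym_def)
  qed
  show "two_level (P - Id)" by unfold_locales (use pair in blast)+
  show "P - Id \<subseteq> X \<times> X" using PX by auto
qed

section \<open>Word length and the final assembly\<close>

text \<open>The factor 2 accommodates quadratic values. Of the 9 extra bits, 2 make up for rounding
  the logarithm down and 7 give the factor 128 below.\<close>

definition word_length :: "nat \<Rightarrow> nat" where
  "word_length n = 2 * nat \<lfloor>log 2 (real n + 1)\<rfloor> + 9"

lemma word_length_bound: "128 * ((n + 1) * (n + 1)) \<le> 2 ^ word_length n"
proof -
  let ?f = "nat \<lfloor>log 2 (real n + 1)\<rfloor>"
  have "log 2 (real n + 1) < real (Suc ?f)" by linarith
  then have "real n + 1 < 2 powr real (Suc ?f)" by (simp add: log_less_iff)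
  then have "real (n + 1) < real (2 ^ Suc ?f)" by (subst (asm) powr_realpow) simp_all
  then have "n + 1 \<le> 2 ^ Suc ?f" by (simp only: of_nat_less_iff)
  then have "(n + 1) * (n + 1) \<le> 2 ^ Suc ?f * 2 ^ Suc ?f" by (intro mult_le_mono)
  also have "\<dots> = 2 ^ (2 * ?f + 2)" by (simp add: power_add mult_2 algebra_simps)
  finally show ?thesis by (simp add: word_length_def power_add)
qed

lemma word_length_bigo: "(\<lambda>n. real (word_length n)) \<in> O(\<lambda>n. ln (real n))"
proof -
  have "(\<lambda>n. 2 * log 2 (real n + 1) + 9) \<in> O(\<lambda>n. ln (real n))" by real_asymp
  moreover have "norm (real (word_length n)) \<le> norm (2 * log 2 (real n + 1) + 9)" for n
  proof -
    have "0 \<le> log 2 (real n + 1)" by simp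
    then show ?thesis by (simp add: word_length_def)
  qed
  then have "(\<lambda>n. real (word_length n)) \<in> O(\<lambda>n. 2 * log 2 (real n + 1) + 9)"
    by (intro landau_o.big_mono always_eventually allI)
  ultimately show ?thesis by (rule landau_o.big_trans[rotated])
qed

lemma decide_time_bigo: "(\<lambda>n. real (decide_time n (n * n) (n * n + 1))) \<in> O(\<lambda>n. real n ^ 4)"
  unfolding decide_time_def of_nat_add of_nat_mult of_nat_numeral of_nat_1 by real_asymp

theorem theorem9:
  shows "\<exists>(prog :: com) (T :: nat \<Rightarrow> nat) (w :: nat \<Rightarrow> nat).
    (\<lambda>n. real (T n)) \<in> O(\<lambda>n. real n ^ 4) \<and>
    (\<lambda>n. real (w n)) \<in> O(\<lambda>n. ln (real n)) \<and>
    (\<forall>(X :: nat set) (F :: nat set set) (P :: nat rel) (input :: nat list).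
       poset_positional_game X F P \<and>
       disjoint_chains X P 2 \<and>
       (\<forall>S\<in>F. card S \<le> 2) \<and>
       encodes input X F P \<longrightarrow>
       (\<exists>t s. exec (w (card X)) prog (initial_state input) t s \<and>
              t \<le> T (card X) \<and>
              (result s = 1 \<longleftrightarrow> has_winning_strategy X F P Maker) \<and>
              (result s = 0 \<longleftrightarrow> has_winning_strategy X F P Breaker)))"
proof (intro exI conjI, rule decide_time_bigo, rule word_length_bigo, intro allI impI, elim conjE)
  fix X :: "nat set" and F P input
  assume game: "poset_positional_game X F P" and chains: "disjoint_chains X P 2"
    and small: "\<forall>S\<in>F. card S \<le> 2" and enc: "encodes input X F P"
  let ?n = "card X"
  have fin: "finite X" and FX: "F \<subseteq> Pow X" using game by (auto simp: poset_positional_game_def)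
  interpret two_level "P - Id" by (rule two_level_disjoint_chains[OF game chains])
  note PX = two_level_disjoint_chains(2)[OF game chains]
  obtain \<nu> rs es where \<nu>: "bij_betw \<nu> X {..<?n}" and rs: "distinct rs" "set rs = map_prod \<nu> \<nu> ` (P - Id)"
    and es: "\<And>e. e \<in> set es \<Longrightarrow> distinct e" "distinct (map set es)" "set (map set es) = image \<nu> ` F"
    and input: "input = [?n, length rs, length es] @ concat (map (\<lambda>(a, b). [a, b]) rs)
             @ concat (map (\<lambda>e. length e # e) es)"
    using enc unfolding encodes_def by blast
  have inj: "inj_on \<nu> X" and img: "\<nu> ` X = {..<?n}" using \<nu> by (auto simp: bij_betw_def)
  interpret game: numbered_game ?n rs es
  proof
    show "set rs \<subseteq> {..<?n} \<times> {..<?n}" unfolding rs(2) img[symmetric] using PX by auto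
    show "a = b" if at: "(a, t) \<in> set rs" and bt: "(b, t) \<in> set rs" for a b t
    proof -
      obtain a' t' where a: "(a', t') \<in> P - Id" "a = \<nu> a'" "t = \<nu> t'"
        using at unfolding rs(2) by auto
      obtain b' t'' where b: "(b', t'') \<in> P - Id" "b = \<nu> b'" "t = \<nu> t''"
        using bt unfolding rs(2) by auto
      have "t' = t''" using a b PX inj by (auto simp: inj_on_def)
      then show ?thesis using below_unique[of a' t' b'] a b by blast
    qed
    show "distinct e \<and> set e \<subseteq> {..<?n} \<and> length e \<le> 2" if e: "e \<in> set es" for e
    proof -
      have "set e \<in> image \<nu> ` F" using e es(3) by auto
      then obtain S where S: "S \<in> F" "set e = \<nu> ` S" by auto
      then have "S \<subseteq> X" using FX by auto
      then have "card (set e) = card S" using S(2) inj by (metis card_image inj_on_subset)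
      then have "length e \<le> 2" using small S(1) distinct_card[OF es(1)[OF e]] by auto
      moreover have "set e \<subseteq> {..<?n}" using S(2) \<open>S \<subseteq> X\<close> img by auto
      ultimately show ?thesis using es(1)[OF e] by simp
    qed
  qed
  have r: "length rs \<le> ?n * ?n" using game.length_rs_le rs(1) .
  have m: "length es \<le> ?n * ?n + 1" using game.length_es_le es(2) .
  interpret ram: word_ram_game ?n rs es "word_length ?n"
  proof
    \<comment> \<open>With \<open>a\<close> in place of the square, the estimates are linear and
      decided by arithmetic.\<close>
    have bound: "a + b + 10 < W" "3 + 2 * r + 3 * m + 10 < W"
      if "128 * (a + 2 * b + 1) \<le> W" "r \<le> a" "m \<le> a + 1" for a b r m W :: nat
      using that by simp_all
    have "128 * (?n * ?n + 2 * ?n + 1) \<le> 2 ^ word_length ?n"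
      using word_length_bound[of ?n] by simp
    from bound[OF this r m] game.length_input_le
    show "?n * ?n + ?n + 10 < 2 ^ word_length ?n" "length game.input + 10 < 2 ^ word_length ?n"
      by simp_all
  qed
  have F: "game.E = image \<nu> ` F" using es(3) by (simp add: game.E_def)
  have inp: "game.input = input" by (simp add: game.input_def input)
  \<comment> \<open>The program judges the numbered game while the strategies live on
    \<open>X\<close>; invariance of the criterion bridges the two.\<close>
  have crit: "maker_criterion (set rs) {..<?n} game.E \<longleftrightarrow> maker_criterion (P - Id) X F"
    using maker_criterion_iso[OF inj PX FX] unfolding rs(2) F img by simp
  obtain t s where run: "exec (word_length ?n) decide (initial_state input) t s"
    and t: "t \<le> decide_time ?n (length rs) (length es)"
    and res: "result s = of_bool (maker_criterion (P - Id) X F)"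
    using ram.runs_decide unfolding crit inp runs_def by blast
  \<comment> \<open>Monotonicity removes the numbers of relations and sets, leaving a bound in
    \<open>card X\<close> alone.\<close>
  have "decide_time ?n (length rs) (length es) \<le> decide_time ?n (?n * ?n) (?n * ?n + 1)"
    using r m unfolding decide_time_def by (intro add_mono mult_mono) auto
  with t have time: "t \<le> decide_time ?n (?n * ?n) (?n * ?n + 1)" by simp
  have "if maker_criterion (P - Id) X F then has_winning_strategy X F P Maker
      else has_winning_strategy X F P Breaker"
    using criterion_decides[OF fin PX FX] small maker_wins_strategy[OF game] breaker_wins_strategy[OF game]
    by (auto split: if_splits)
  \<comment> \<open>The flag is 0 or 1 and the indicated player wins; the reverse implications hold
    because both players cannot win.\<close>
  then have "(result s = 1 \<longleftrightarrow> has_winning_strategy X F P Maker) \<and>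
      (result s = 0 \<longleftrightarrow> has_winning_strategy X F P Breaker)"
    using not_both_winning_strategies[OF game] res by (auto split: if_splits)
  with run time show "\<exists>t s. exec (word_length ?n) decide (initial_state input) t s \<and>
      t \<le> decide_time ?n (?n * ?n) (?n * ?n + 1) \<and>
      (result s = 1 \<longleftrightarrow> has_winning_strategy X F P Maker) \<and>
      (result s = 0 \<longleftrightarrow> has_winning_strategy X F P Breaker)"
    by (intro exI[of _ t] exI[of _ s]) simp
qed

end
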